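(* Let $K$ be an algebraically closed field of characteristic different from two and three. Any cubic rational expression $R(x)$ over $K$ is equivalent either to $x^3$, or to \[R_c(x):=\frac{x^3+(c-2)x^2}{(2c-1)x-c}\] for some $c\in K\setminus\{0,1\}$. For $c,c'\in K\setminus\{0,1\}$, the expressions $R_c(x)$ and $R_{c'}(x)$ are equivalent if and only if $c$ and $c'$ belong to the same $S$-orbit. The cubic expression $R_c(x)$ has ramification points $\infty,0,1,\lambda$, with corresponding branch points $\infty,0,1,\mu$, where $\lambda=-c(c-2)/(2c-1)$ and $\mu=-c(c-2)^3/(2c-1)^3$ (interpreted as $\infty$ when $2c-1=0$). These four ramification points are distinct, and so are the four branch points, except when $c\in\{1/2,2,-1\}$; all those exceptional values of $c$ give expressions equivalent to $R_{1/2}(x)=-2x^3+3x^2$, whose ramification points are $\infty,0,1$, with $\infty$ of ramification index three.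
   Context: A rational expression $R(x)=g(x)/h(x)\in K(x)$ with $g,h$ coprime has degree $\max(\deg g,\deg h)$; cubic means degree $3$. The group $G(K)=\mathrm{PGL}_2(K)\times\mathrm{PGL}_2(K)$, with $\mathrm{PGL}_2(K)$ identified with the group of degree-one rational expressions (Möbius transformations) under composition, acts on $K(x)$ by $(B,A)\cdot R(x)=B(R(A^{-1}(x)))$; two rational expressions are equivalent if they lie in the same $G(K)$-orbit. A nonconstant $R$ defines a map $\mathbb P^1(K)\to\mathbb P^1(K)$ (with $\mathbb P^1(K)=K\cup\{\infty\}$); a ramification point is a point $P\in\mathbb P^1(K)$ whose ramification index $e_R(P)$ (the multiplicity of $P$ in the fibre $R^{-1}(R(P))$) exceeds $1$, and $R(P)$ is the corresponding branch point. $S$ denotes the group of order six of Möbius transformations of $K\cup\{\infty\}$ generated by $\lambda\mapsto 1/\lambda$ and $\lambda\mapsto 1-\lambda$; it acts on $K\setminus\{0,1\}$. *)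

theory Defs
  imports
    "HOL-Computational_Algebra.Polynomial"
    "HOL-Computational_Algebra.Fraction_Field"
    "HOL-Algebra.Group_Action"
    "HOL-Algebra.Generated_Groups"
begin

section \<open>Rational expressions in lowest terms\<close>

definition is_reduced :: "'a::field poly fract \<Rightarrow> 'a poly \<times> 'a poly \<Rightarrow> bool" where
  "is_reduced R = (\<lambda>(g, h). R = Fract g h \<and> coprime g h \<and> lead_coeff h = 1)"

text \<open>The denominator is normalised to be monic only to make the pair unique. The library's
  \<open>quot_of_fract\<close> is not used because it would impose further type classes on the field.\<close>

definition rat_num_den :: "'a::field poly fract \<Rightarrow> 'a poly \<times> 'a poly" where
  "rat_num_den R = (THE p. is_reduced R p)"

definition rat_num :: "'a::field poly fract \<Rightarrow> 'a poly" where
  "rat_num R = fst (rat_num_den R)"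

definition rat_den :: "'a::field poly fract \<Rightarrow> 'a poly" where
  "rat_den R = snd (rat_num_den R)"

lemma poly_bezout:
  fixes g h :: "'a::field poly"
  assumes "h \<noteq> 0"
  obtains u v d where "d = u * g + v * h" "d dvd g" "d dvd h" "d \<noteq> 0"
proof -
  define I where "I = {p. p \<noteq> 0 \<and> (\<exists>u v. p = u * g + v * h)}"
  have "h = 0 * g + 1 * h" by simp
  with assms have "h \<in> I" unfolding I_def by blast
  then obtain d where d: "d \<in> I" and min: "\<And>p. p \<in> I \<Longrightarrow> degree d \<le> degree p"
    using ex_has_least_nat[of "\<lambda>p. p \<in> I" h degree] by blast
  from d obtain u v where uv: "d = u * g + v * h" and "d \<noteq> 0" by (auto simp: I_def)
  have dvd: "d dvd p" if p: "p = s * g + t * h" for p s t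
  proof (rule ccontr)
    assume "\<not> d dvd p"
    then have nz: "p mod d \<noteq> 0" by (simp add: dvd_eq_mod_eq_0)
    have "p mod d = p - (p div d) * d" by (simp add: minus_div_mult_eq_mod)
    also have "\<dots> = (s - (p div d) * u) * g + (t - (p div d) * v) * h"
      by (subst (2) uv) (simp add: p algebra_simps)
    finally have "p mod d \<in> I" using nz unfolding I_def by blast
    with min have "degree d \<le> degree (p mod d)" by blast
    moreover have "degree (p mod d) < degree d"
      using degree_mod_less[OF \<open>d \<noteq> 0\<close>, of p] nz by simp
    ultimately show False by simp
  qed
  have "d dvd g" by (rule dvd[of g 1 0]) simp
  moreover have "d dvd h" by (rule dvd[of h 0 1]) simp
  ultimately show ?thesis using that uv \<open>d \<noteq> 0\<close> by blast
qed

lemma ex1_is_reduced: "\<exists>!p. is_reduced R p"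
proof -
  have bez: "\<exists>u v. u * g + v * h = 1" if cop: "coprime g h" and h: "h \<noteq> 0" for g h :: "'a poly"
  proof -
    obtain u v d where d: "d = u * g + v * h" "d dvd g" "d dvd h"
      by (rule poly_bezout[OF h, of g])
    with cop have "d dvd 1" by (meson coprime_common_divisor)
    then obtain k where "1 = d * k" by (elim dvdE)
    then have "(k * u) * g + (k * v) * h = 1" by (simp add: d algebra_simps)
    then show ?thesis by blast
  qed
  obtain a b where ab: "R = Fract a b" "b \<noteq> 0" by (cases R) auto
  obtain u v d where d: "d = u * a + v * b" "d dvd a" "d dvd b" "d \<noteq> 0"
    by (rule poly_bezout[OF ab(2), of a])
  from d(2,3) obtain g h where gh: "a = d * g" "b = d * h" using dvdE by metis
  define l where "l = inverse (lead_coeff h)"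
  have h0: "h \<noteq> 0" using gh ab by auto
  then have l0: "l \<noteq> 0" by (simp add: l_def)
  have "d * (u * g + v * h) = d * 1" using d(1) by (simp add: gh algebra_simps)
  with d(4) have uv: "u * g + v * h = 1" using mult_left_cancel by blast
  have "is_unit c" if "c dvd smult l g" "c dvd smult l h" for c
  proof -
    have "c dvd g" "c dvd h" using that l0 by (simp_all add: dvd_smult_iff)
    then have "c dvd u * g + v * h" by simp
    with uv show ?thesis by simp
  qed
  then have "coprime (smult l g) (smult l h)" by (rule coprimeI)
  moreover have "R = Fract (smult l g) (smult l h)"
    using ab d(4) h0 l0 by (simp add: gh eq_fract algebra_simps)
  moreover have "lead_coeff (smult l h) = 1" using h0 by (simp add: l_def)
  ultimately have ex: "is_reduced R (smult l g, smult l h)" by (simp add: is_reduced_def)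
  have uniq: "g1 = g2 \<and> h1 = h2"
    if 1: "is_reduced R (g1, h1)" and 2: "is_reduced R (g2, h2)" for g1 h1 g2 h2
  proof -
    have nz: "h1 \<noteq> 0" "h2 \<noteq> 0" using 1 2 by (auto simp: is_reduced_def)
    have eq: "g1 * h2 = g2 * h1" using 1 2 nz by (auto simp: is_reduced_def eq_fract)
    have "h1 dvd h2"
    proof -
      obtain u v where "u * g1 + v * h1 = 1" using bez[of g1 h1] 1 nz by (auto simp: is_reduced_def)
      then have "h2 = u * (g1 * h2) + v * h1 * h2"
        by (metis distrib_right mult.assoc mult_1)
      also have "\<dots> = h1 * (u * g2 + v * h2)" by (simp add: eq algebra_simps)
      finally show ?thesis by (metis dvd_triv_left)
    qed
    moreover have "h2 dvd h1"
    proof -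
      obtain u v where "u * g2 + v * h2 = 1" using bez[of g2 h2] 2 nz by (auto simp: is_reduced_def)
      then have "h1 = u * (g2 * h1) + v * h2 * h1"
        by (metis distrib_right mult.assoc mult_1)
      also have "\<dots> = h2 * (u * g1 + v * h1)" by (simp add: eq[symmetric] algebra_simps)
      finally show ?thesis by (metis dvd_triv_left)
    qed
    ultimately have deg: "degree h1 = degree h2"
      using nz by (intro antisym dvd_imp_degree_le)
    obtain k where k: "h2 = h1 * k" using \<open>h1 dvd h2\<close> by (elim dvdE)
    with nz have "k \<noteq> 0" by auto
    with k nz deg have "degree k = 0" by (simp add: degree_mult_eq)
    moreover have "lead_coeff k = 1"
      using 1 2 k by (simp add: is_reduced_def lead_coeff_mult)
    ultimately have "k = 1" by (auto elim!: degree_eq_zeroE simp: one_pCons)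
    with k have "h1 = h2" by simp
    with eq nz show ?thesis by simp
  qed
  show ?thesis using ex uniq by (intro ex_ex1I) (auto simp: split_paired_all)
qed

lemma is_reduced_rat_num_den: "is_reduced R (rat_num R, rat_den R)"
  using theI'[OF ex1_is_reduced[of R]] by (simp add: rat_num_def rat_den_def rat_num_den_def)

lemma rat_num_den_eqI:
  "is_reduced R (g, h) \<Longrightarrow> rat_num R = g"
  "is_reduced R (g, h) \<Longrightarrow> rat_den R = h"
  using ex1_is_reduced[of R] is_reduced_rat_num_den[of R] by blast+

definition rat_degree :: "'a::field poly fract \<Rightarrow> nat" where
  "rat_degree R = max (degree (rat_num R)) (degree (rat_den R))"

section \<open>Composition and equivalence\<close>

abbreviation rat_const :: "'a::field \<Rightarrow> 'a poly fract" where
  "rat_const a \<equiv> Fract [:a:] 1"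

text \<open>\<open>rat_comp R T\<close> is \<open>R(T(x))\<close>: numerator and denominator of \<open>R\<close> are evaluated at the element
  \<open>T\<close> of \<open>K(x)\<close>. The denominator does not vanish when \<open>T\<close> is nonconstant.\<close>

definition rat_comp :: "'a::field poly fract \<Rightarrow> 'a poly fract \<Rightarrow> 'a poly fract" where
  "rat_comp R T =
     poly (map_poly rat_const (rat_num R)) T / poly (map_poly rat_const (rat_den R)) T"

definition PGL2 :: "'a::field poly fract monoid" where
  "PGL2 = \<lparr>carrier = {A. rat_degree A = 1}, mult = rat_comp, one = Fract [:0, 1:] 1\<rparr>"

definition rat_act ::
    "'a::field poly fract \<times> 'a poly fract \<Rightarrow> 'a poly fract \<Rightarrow> 'a poly fract" where
  "rat_act = (\<lambda>(B, A) R. rat_comp B (rat_comp R (inv\<^bsub>PGL2\<^esub> A)))"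

definition same_orbit ::
    "('g, 'm) monoid_scheme \<Rightarrow> 'b set \<Rightarrow> ('g \<Rightarrow> 'b \<Rightarrow> 'b) \<Rightarrow> 'b \<Rightarrow> 'b \<Rightarrow> bool" where
  "same_orbit G E \<phi> x y \<longleftrightarrow> (\<exists>Q \<in> orbits G E \<phi>. x \<in> Q \<and> y \<in> Q)"

text \<open>Constants are excluded from the set acted upon: a Moebius transformation with a pole at
  \<open>b\<close> sends the constant expression \<open>b\<close> outside \<open>K(x)\<close>.\<close>

definition rat_equiv :: "'a::field poly fract \<Rightarrow> 'a poly fract \<Rightarrow> bool" where
  "rat_equiv = same_orbit (PGL2 \<times>\<times> PGL2) {R. rat_degree R > 0} rat_act"

section \<open>The induced map on the projective line and its ramification\<close>

datatype 'a proj_line = Aff 'a | Infty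

definition rat_map :: "'a::field poly fract \<Rightarrow> 'a proj_line \<Rightarrow> 'a proj_line" where
  "rat_map R P = (case P of
     Aff a \<Rightarrow>
       if poly (rat_den R) a = 0 then Infty else Aff (poly (rat_num R) a / poly (rat_den R) a)
   | Infty \<Rightarrow>
       if degree (rat_num R) > degree (rat_den R) then Infty
       else Aff (coeff (rat_num R) (degree (rat_den R)) / lead_coeff (rat_den R)))"

text \<open>With \<open>R = g/h\<close> in lowest terms and \<open>d\<close> its degree, the fibre over \<open>b\<close> (over \<open>\<infinity>\<close>) is the zero
  divisor of the degree \<open>d\<close> binary form obtained by homogenising \<open>g - b h\<close> (respectively \<open>h\<close>).
  The multiplicity at \<open>\<infinity>\<close> of that form is the drop of the degree of the polynomial below \<open>d\<close>.\<close>

definition fibre_poly :: "'a::field poly fract \<Rightarrow> 'a proj_line \<Rightarrow> 'a poly" where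
  "fibre_poly R Q = (case Q of
     Aff b \<Rightarrow> rat_num R - smult b (rat_den R)
   | Infty \<Rightarrow> rat_den R)"

definition fibre_mult :: "'a::field poly fract \<Rightarrow> 'a proj_line \<Rightarrow> 'a proj_line \<Rightarrow> nat" where
  "fibre_mult R Q P = (case P of
     Aff a \<Rightarrow> Polynomial.order a (fibre_poly R Q)
   | Infty \<Rightarrow> rat_degree R - degree (fibre_poly R Q))"

text \<open>Meaningful for nonconstant \<open>R\<close> only.\<close>

definition ram_index :: "'a::field poly fract \<Rightarrow> 'a proj_line \<Rightarrow> nat" where
  "ram_index R P = fibre_mult R (rat_map R P) P"

definition ramification_points :: "'a::field poly fract \<Rightarrow> 'a proj_line set" where
  "ramification_points R = {P. ram_index R P > 1}"

section \<open>The group of anharmonic transformations\<close>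

definition anharmonic_group :: "'a::field poly fract monoid" where
  "anharmonic_group =
     PGL2\<lparr>carrier := generate PGL2 {Fract 1 [:0, 1:], Fract [:1, -1:] 1}\<rparr>"

definition same_S_orbit :: "'a::field \<Rightarrow> 'a \<Rightarrow> bool" where
  "same_S_orbit c c' \<longleftrightarrow>
     same_orbit anharmonic_group (Aff ` (UNIV - {0, 1})) rat_map (Aff c) (Aff c')"

section \<open>The family of cubic expressions\<close>

definition R_cubic :: "'a::field \<Rightarrow> 'a poly fract" where
  "R_cubic c = Fract [:0, 0, c - 2, 1:] [:- c, 2 * c - 1:]"

definition ram_lambda :: "'a::field \<Rightarrow> 'a proj_line" where
  "ram_lambda c =
     (if 2 * c - 1 = 0 then Infty else Aff (- c * (c - 2) / (2 * c - 1)))"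

definition branch_mu :: "'a::field \<Rightarrow> 'a proj_line" where
  "branch_mu c =
     (if 2 * c - 1 = 0 then Infty else Aff (- c * (c - 2) ^ 3 / (2 * c - 1) ^ 3))"

end

theory Submission
  imports Defs
begin

text \<open>
  A cubic expression has a critical point, a projective root of the Wronskian \<open>g' h - g h'\<close>. Moving
  it and its value to \<open>\<infinity>\<close> gives a polynomial or an expression with a linear denominator. The
  remaining critical points then cannot all coincide, except in the case of \<open>x\<^sup>3\<close>; moving two of them
  to \<open>0\<close> and \<open>1\<close>, and their values likewise, leaves exactly \<open>R\<^sub>c\<close>.

  To separate the classes, write \<open>p\<^sub>i\<^sub>j = g\<^sub>i h\<^sub>j - g\<^sub>j h\<^sub>i\<close>. The \<open>SL\<^sub>2\<close>-invariant pairing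
  \<open>P = 3 p\<^sub>0\<^sub>3 - p\<^sub>1\<^sub>2\<close> of binary cubics and the Bezout determinant \<open>D\<close> of \<open>g, h\<close> both transform by powers
  of the determinants of the two Moebius transformations, in such a way that \<open>P\<^sup>3 / D\<close> is invariant.
  For \<open>R\<^sub>c\<close> it equals \<open>-4 (c\<^sup>2 - c + 1)\<^sup>3 / (c\<^sup>2 (c - 1)\<^sup>2)\<close>, whose fibres are the orbits of \<open>S\<close>. Conversely,
  \<open>R\<^bsub>1 - c\<^esub>(x) = 1 - R\<^sub>c(1 - x)\<close> and \<open>R\<^bsub>1/c\<^esub>(x) = 1 / R\<^sub>c(1/x)\<close>.
\<close>

section \<open>Composition and the group of Moebius transformations\<close>

text \<open>Opaque names for constants and for the variable: the simplifier would rewrite inside and merge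
  the \<open>Fract\<close> terms.\<close>

definition rc :: "'a::field \<Rightarrow> 'a poly fract" where
  "rc a = rat_const a"

lemma rc_0 [simp]: "rc 0 = 0"
  and rc_1 [simp]: "rc 1 = 1"
  by (simp_all add: rc_def fract_collapse flip: one_pCons Zero_fract_def One_fract_def)

lemma rc_add [simp]: "rc (a + b) = rc a + rc b"
  and rc_mult [simp]: "rc (a * b) = rc a * rc b"
  and rc_minus [simp]: "rc (- a) = - rc a"
  and rc_diff [simp]: "rc (a - b) = rc a - rc b"
  by (simp_all add: rc_def mult.commute)

lemma rc_eq_iff [simp]: "rc a = rc b \<longleftrightarrow> a = b"
  by (simp add: rc_def eq_fract)

lemma rc_eq_0_iff [simp]: "rc a = 0 \<longleftrightarrow> a = 0"
  using rc_eq_iff[of a 0] by (simp del: rc_eq_iff)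

lemma rc_divide [simp]: "rc (a / b) = rc a / rc b"
proof (cases "b = 0")
  case False
  have "rc (a / b) * rc b = rc a" using False by (simp flip: rc_mult)
  then show ?thesis using False by (simp add: field_simps)
qed simp

section \<open>Substitution of a rational expression into polynomials\<close>

definition ev :: "'a::field poly fract \<Rightarrow> 'a poly \<Rightarrow> 'a poly fract" where
  "ev T p = poly (map_poly rc p) T"

lemma ev_0 [simp]: "ev T 0 = 0"
  by (simp add: ev_def)

lemma ev_pCons [simp]: "ev T (pCons a p) = rc a + T * ev T p"
  by (simp add: ev_def map_poly_pCons)

lemma ev_1 [simp]: "ev T 1 = 1"
  by (simp add: one_pCons)

lemma ev_add [simp]: "ev T (p + q) = ev T p + ev T q"
  by (induction p q rule: poly_induct2) (simp_all add: algebra_simps)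

lemma ev_smult [simp]: "ev T (smult a p) = rc a * ev T p"
  by (induction p) (simp_all add: algebra_simps)

lemma ev_mult [simp]: "ev T (p * q) = ev T p * ev T q"
  by (induction p) (simp_all add: algebra_simps)

lemma ev_minus [simp]: "ev T (- p) = - ev T p"
  by (induction p) (simp_all add: algebra_simps)

lemma ev_diff [simp]: "ev T (p - q) = ev T p - ev T q"
  using ev_add[of T p "- q"] by simp

definition nonconst :: "'a::field poly fract \<Rightarrow> bool" where
  "nonconst T \<longleftrightarrow> (\<forall>k. T \<noteq> rc k)"

text \<open>Nonconstant elements of \<open>K(x)\<close> are transcendental over \<open>K\<close>: a
  polynomial splits into linear factors \<open>x - r\<close>, and no factor \<open>T - r\<close>
  vanishes because \<open>T\<close> is not a constant.\<close>

lemma ev_eq_0_iff: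
  fixes T :: "'a::alg_closed_field poly fract"
  assumes "nonconst T"
  shows "ev T p = 0 \<longleftrightarrow> p = 0"
proof
  show "ev T p = 0 \<Longrightarrow> p = 0"
  proof (induction "degree p" arbitrary: p rule: less_induct)
    case less
    show ?case
    proof (cases "degree p = 0")
      case True
      then obtain a where "p = [:a:]" by (elim degree_eq_zeroE)
      with less.prems show ?thesis by simp
    next
      case False
      then obtain r where "poly p r = 0" using alg_closed_imp_poly_has_root by blast
      then obtain q where q: "p = [:- r, 1:] * q" by (auto simp: poly_eq_0_iff_dvd)
      have "q \<noteq> 0" using False q by auto
      then have "degree q < degree p" unfolding q by (subst degree_mult_eq) auto
      moreover have "T - rc r \<noteq> 0" using assms by (simp add: nonconst_def)
      then have "ev T q = 0" using less.prems unfolding q ev_mult by simp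
      ultimately have "q = 0" by (rule less.hyps)
      then show ?thesis using q by simp
    qed
  qed
qed simp

definition rat_X :: "'a::field poly fract" where
  "rat_X = Fract [:0, 1:] 1"

lemma ev_rat_X: "ev rat_X p = Fract p 1"
  by (induction p) (simp_all add: rc_def rat_X_def Zero_fract_def)

text \<open>Turns a \<open>Fract\<close> term into a quotient in the field \<open>K(x)\<close>,
  where field arithmetic applies. Both sides are 0 when \<open>h = 0\<close>.\<close>

lemma Fract_conv: "Fract g h = ev rat_X g / ev rat_X h"
  by (cases "h = 0") (simp_all add: ev_rat_X fract_collapse)

section \<open>Lowest terms and degree\<close>

lemma rat_num_den: "R = Fract (rat_num R) (rat_den R)" "rat_den R \<noteq> 0"
  "coprime (rat_num R) (rat_den R)"
  using is_reduced_rat_num_den[of R] by (auto simp: is_reduced_def)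

lemma rat_num_den_Fract:
  assumes "coprime g h" "h \<noteq> 0"
  shows "rat_num (Fract g h) = smult (inverse (lead_coeff h)) g"
    and "rat_den (Fract g h) = smult (inverse (lead_coeff h)) h"
    and "rat_degree (Fract g h) = max (degree g) (degree h)"
proof -
  let ?l = "inverse (lead_coeff h)"
  have l: "?l \<noteq> 0" using assms by simp
  have "is_reduced (Fract g h) (smult ?l g, smult ?l h)"
    using assms l
    by (auto simp: is_reduced_def eq_fract coprime_def dvd_smult_iff)
  then show 1: "rat_num (Fract g h) = smult ?l g" and 2: "rat_den (Fract g h) = smult ?l h"
    by (auto intro: rat_num_den_eqI)
  show "rat_degree (Fract g h) = max (degree g) (degree h)"
    using l by (simp add: rat_degree_def 1 2)
qed

lemma rat_degree_pos_iff: "rat_degree R > 0 \<longleftrightarrow> nonconst R"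
proof -
  have "rat_degree (rc k) = 0" for k :: 'a
    unfolding rc_def by (subst rat_num_den_Fract) auto
  moreover have "\<exists>k. R = rc k" if "rat_degree R = 0"
  proof -
    from that have "degree (rat_num R) = 0" "degree (rat_den R) = 0"
      by (auto simp: rat_degree_def)
    then obtain a b where "rat_num R = [:a:]" "rat_den R = [:b:]" by (metis degree_eq_zeroE)
    with rat_num_den[of R] have "R = rat_const (a / b)" by (simp add: eq_fract)
    then show ?thesis unfolding rc_def ..
  qed
  ultimately show ?thesis by (auto simp: nonconst_def)
qed

section \<open>Composition with a nonconstant expression\<close>

lemma rat_comp_ev_num_den: "rat_comp R T = ev T (rat_num R) / ev T (rat_den R)"
  by (simp add: rat_comp_def ev_def rc_def[abs_def])

context
  fixes T :: "'a::alg_closed_field poly fract"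
  assumes T: "nonconst T"
begin

text \<open>Composition may be computed from any fraction representing the outer expression, not
  only from its lowest terms: cross-multiplication survives substitution, and nonzero denominators
  stay nonzero by \<open>ev_eq_0_iff\<close>.\<close>

lemma rat_comp_Fract: "rat_comp (Fract g h) T = ev T g / ev T h"
proof (cases "h = 0")
  case True
  have "is_reduced (0 :: 'a poly fract) (0, 1)" by (simp add: is_reduced_def fract_collapse)
  then have "rat_num (0 :: 'a poly fract) = 0" by (rule rat_num_den_eqI)
  then show ?thesis using True by (simp add: rat_comp_ev_num_den fract_collapse)
next
  case False
  let ?R = "Fract g h"
  have "g * rat_den ?R = rat_num ?R * h"
    using rat_num_den[of ?R] False by (simp add: eq_fract)
  then have "ev T g * ev T (rat_den ?R) = ev T (rat_num ?R) * ev T h"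
    by (metis ev_mult)
  then show ?thesis
    using False rat_num_den(2)[of ?R] ev_eq_0_iff[OF T]
    by (simp add: rat_comp_ev_num_den frac_eq_eq)
qed

lemma rat_comp_const: "rat_comp (rc a) T = rc a"
  by (subst rc_def) (simp add: rat_comp_Fract)

lemma rat_comp_add: "rat_comp (R + S) T = rat_comp R T + rat_comp S T"
  by (cases R; cases S) (simp add: rat_comp_Fract ev_eq_0_iff[OF T] add_frac_eq)

lemma rat_comp_mult: "rat_comp (R * S) T = rat_comp R T * rat_comp S T"
  by (cases R; cases S) (simp add: rat_comp_Fract)

lemma rat_comp_inverse: "rat_comp (inverse R) T = inverse (rat_comp R T)"
  by (cases R) (simp add: rat_comp_Fract)

lemma rat_comp_divide: "rat_comp (R / S) T = rat_comp R T / rat_comp S T"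
  by (simp add: divide_inverse rat_comp_mult rat_comp_inverse)

text \<open>A relation \<open>g(T) = k h(T)\<close> forces \<open>g = k h\<close>, since
  \<open>T\<close> is transcendental.\<close>

lemma rat_comp_eq_const:
  assumes "rat_comp R T = rc k"
  shows "R = rc k"
proof (cases R)
  case (Fract g h)
  then have "ev T g = ev T (smult k h)"
    using assms ev_eq_0_iff[OF T, of h] by (simp add: rat_comp_Fract field_simps)
  then have "ev T (g - smult k h) = 0" by simp
  then have "g - smult k h = 0" using ev_eq_0_iff[OF T] by blast
  then have "g = smult k h" by simp
  then show ?thesis using Fract by (simp add: rc_def eq_fract)
qed

lemma nonconst_rat_comp: "nonconst R \<Longrightarrow> nonconst (rat_comp R T)"
  using rat_comp_eq_const by (auto simp: nonconst_def)

lemma rat_comp_X: "rat_comp rat_X T = T"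
  by (simp add: rat_X_def rat_comp_Fract)

lemma rat_comp_ev: "rat_comp (ev S p) T = ev (rat_comp S T) p"
  using rat_comp_const[of 0]
  by (induction p) (simp_all add: rat_comp_add rat_comp_mult rat_comp_const)

end

lemma nonconst_X [simp]: "nonconst rat_X"
  by (simp add: nonconst_def rat_X_def rc_def eq_fract)

lemma rat_comp_X_right: "rat_comp R rat_X = R"
  for R :: "'a::alg_closed_field poly fract"
  by (cases R) (simp add: rat_comp_Fract flip: Fract_conv)

lemma rat_comp_assoc:
  fixes R S T :: "'a::alg_closed_field poly fract"
  assumes "nonconst S" "nonconst T"
  shows "rat_comp (rat_comp R S) T = rat_comp R (rat_comp S T)"
  using assms
  by (cases R) (simp add: rat_comp_Fract nonconst_rat_comp rat_comp_divide rat_comp_ev)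

section \<open>Moebius transformations as two by two matrices\<close>

definition moeb :: "'a::field \<Rightarrow> 'a \<Rightarrow> 'a \<Rightarrow> 'a \<Rightarrow> 'a poly fract" where
  "moeb a b c d = Fract [:b, a:] [:d, c:]"

text \<open>A common divisor of \<open>a x + b\<close> and \<open>c x + d\<close> divides the
  combination \<open>a (c x + d) - c (a x + b)\<close>, which is the determinant.\<close>

lemma moeb_coprime:
  fixes a b c d :: "'a::field"
  assumes "a * d - b * c \<noteq> 0"
  shows "coprime [:b, a:] [:d, c:]"
proof (rule coprimeI)
  fix p assume "p dvd [:b, a:]" "p dvd [:d, c:]"
  then have "p dvd smult a [:d, c:] - smult c [:b, a:]" by (intro dvd_diff dvd_smult)
  also have "smult a [:d, c:] - smult c [:b, a:] = [:a * d - b * c:]" by (simp add: mult.commute)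
  finally show "is_unit p"
    using assms is_unit_const_poly_iff
    by (metis dvd_trans dvd_field_iff is_unit_pCons_iff)
qed

lemma PGL2_iff:
  "A \<in> carrier PGL2 \<longleftrightarrow> (\<exists>a b c d. a * d - b * c \<noteq> 0 \<and> A = moeb a b c d)"
proof
  assume "A \<in> carrier PGL2"
  then have 1: "max (degree (rat_num A)) (degree (rat_den A)) = 1"
    by (simp add: PGL2_def rat_degree_def)
  define a b c d where "a = coeff (rat_num A) 1" "b = coeff (rat_num A) 0"
    "c = coeff (rat_den A) 1" "d = coeff (rat_den A) 0"
  note abcd = this
  have deg1: "p = [:coeff p 0, coeff p 1:]" if "degree p \<le> 1" for p :: "'a poly"
    using that by (intro poly_eqI) (auto simp: coeff_pCons coeff_eq_0 split: nat.splits)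
  have n: "rat_num A = [:b, a:]" and h: "rat_den A = [:d, c:]"
    using deg1[of "rat_num A"] deg1[of "rat_den A"] 1 abcd by auto
  have "a * d - b * c \<noteq> 0"
  proof
    \<comment> \<open>With zero determinant numerator and denominator are proportional, so whichever
      of them has degree one is a common divisor, contrary to lowest terms.\<close>
    assume z: "a * d - b * c = 0"
    have "a \<noteq> 0 \<or> c \<noteq> 0" using 1 by (auto simp: n h split: if_splits)
    have "[:b, a:] = smult (a / c) [:d, c:]" if "c \<noteq> 0" using that z by (simp add: field_simps)
    moreover have "[:d, c:] = smult (c / a) [:b, a:]" if "a \<noteq> 0" using that z by (simp add: field_simps)
    ultimately obtain q where q: "q dvd [:b, a:]" "q dvd [:d, c:]" "degree q = 1"
      using \<open>a \<noteq> 0 \<or> c \<noteq> 0\<close>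
      by (metis degree_pCons_eq_if One_nat_def degree_pCons_0 pCons_eq_0_iff dvd_refl dvd_smult)
    then have "is_unit q" using rat_num_den(3)[of A] n h coprime_common_divisor by metis
    then show False using q(3) is_unit_iff_degree[of q] by (cases "q = 0") auto
  qed
  moreover have "A = moeb a b c d" using rat_num_den(1)[of A] by (simp add: n h moeb_def)
  ultimately show "\<exists>a b c d. a * d - b * c \<noteq> 0 \<and> A = moeb a b c d" by blast
next
  assume "\<exists>a b c d. a * d - b * c \<noteq> 0 \<and> A = moeb a b c d"
  then obtain a b c d where abcd: "a * d - b * c \<noteq> 0" "A = moeb a b c d" by blast
  then have "[:d, c:] \<noteq> 0" by auto
  then show "A \<in> carrier PGL2"
    using rat_num_den_Fract(3)[OF moeb_coprime[OF abcd(1)]] abcd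
    by (auto simp: PGL2_def moeb_def)
qed

lemma nonconst_PGL2: "A \<in> carrier PGL2 \<Longrightarrow> nonconst A"
  using rat_degree_pos_iff[of A] by (simp add: PGL2_def)

lemma nonconst_moeb: "a * d - b * c \<noteq> 0 \<Longrightarrow> nonconst (moeb a b c d)"
  using PGL2_iff nonconst_PGL2 by blast

lemma rat_comp_moeb_left:
  fixes T :: "'a::alg_closed_field poly fract"
  assumes "nonconst T"
  shows "rat_comp (moeb a b c d) T
    = (rc a * T + rc b) / (rc c * T + rc d)"
  using assms by (simp add: moeb_def rat_comp_Fract algebra_simps)

lemma moeb_eq:
  "moeb a b c d = (rc a * rat_X + rc b) / (rc c * rat_X + rc d)"
  unfolding moeb_def by (subst Fract_conv) (simp add: algebra_simps)

text \<open>The coefficient matrices multiply under composition.\<close>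

lemma rat_comp_moeb:
  fixes a :: "'a::alg_closed_field"
  assumes "a' * d' - b' * c' \<noteq> 0"
  shows "rat_comp (moeb a b c d) (moeb a' b' c' d') =
    moeb (a * a' + b * c') (a * b' + b * d') (c * a' + d * c') (c * b' + d * d')"
proof -
  have "[:d', c':] \<noteq> 0" using assms by auto
  then have nz: "rc c' * rat_X + rc d' \<noteq> 0"
    by (simp add: rat_X_def rc_def Zero_fract_def eq_fract)
  show ?thesis
    using nz unfolding rat_comp_moeb_left[OF nonconst_moeb[OF assms]]
    by (simp add: moeb_eq divide_simps) (simp add: algebra_simps)
qed

lemma PGL2_simps:
  "mult PGL2 = rat_comp" "one PGL2 = rat_X"
  by (simp_all add: PGL2_def rat_X_def)

lemma moeb_scalar: "k \<noteq> 0 \<Longrightarrow> moeb k 0 0 k = rat_X"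
  by (simp add: moeb_eq)

lemma moeb_in_PGL2: "a * d - b * c \<noteq> 0 \<Longrightarrow> moeb a b c d \<in> carrier PGL2"
  using PGL2_iff by blast

lemma rat_X_in_PGL2 [simp]: "rat_X \<in> carrier PGL2"
  using moeb_in_PGL2[of 1 1 0 0] by (metis moeb_scalar diff_zero mult_1 mult_zero_left one_neq_zero)

lemma group_PGL2: "group (PGL2 :: 'a::alg_closed_field poly fract monoid)"
proof (rule groupI)
  fix A B C :: "'a poly fract"
  assume A: "A \<in> carrier PGL2" and B: "B \<in> carrier PGL2" and C: "C \<in> carrier PGL2"
  obtain a b c d where 1: "a * d - b * c \<noteq> 0" "A = moeb a b c d" using A PGL2_iff by blast
  obtain a' b' c' d' where 2: "a' * d' - b' * c' \<noteq> 0" "B = moeb a' b' c' d'"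
    using B PGL2_iff by blast
  have "(a * a' + b * c') * (c * b' + d * d') - (a * b' + b * d') * (c * a' + d * c')
      = (a * d - b * c) * (a' * d' - b' * c')" by algebra
  then show "A \<otimes>\<^bsub>PGL2\<^esub> B \<in> carrier PGL2"
    using 1 2 by (auto simp: PGL2_simps rat_comp_moeb intro!: moeb_in_PGL2)
  show "A \<otimes>\<^bsub>PGL2\<^esub> B \<otimes>\<^bsub>PGL2\<^esub> C = A \<otimes>\<^bsub>PGL2\<^esub> (B \<otimes>\<^bsub>PGL2\<^esub> C)"
    using B C by (simp add: PGL2_simps rat_comp_assoc nonconst_PGL2)
next
  show "\<one>\<^bsub>PGL2\<^esub> \<in> carrier (PGL2 :: 'a poly fract monoid)"
    by (simp add: PGL2_simps)
next
  fix A :: "'a poly fract"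
  assume A: "A \<in> carrier PGL2"
  then show "\<one>\<^bsub>PGL2\<^esub> \<otimes>\<^bsub>PGL2\<^esub> A = A" by (simp add: PGL2_simps rat_comp_X nonconst_PGL2)
  obtain a b c d where 1: "a * d - b * c \<noteq> 0" "A = moeb a b c d" using A PGL2_iff by blast
  \<comment> \<open>The adjugate matrix is the inverse up to the determinant, a scalar that does not
    affect the Moebius transformation.\<close>
  have "d * a - (- b) * (- c) \<noteq> 0" using 1(1) by (simp add: mult.commute)
  then have "moeb d (- b) (- c) a \<in> carrier PGL2" by (rule moeb_in_PGL2)
  moreover have "rat_comp (moeb d (- b) (- c) a) A = rat_X"
    unfolding 1(2) rat_comp_moeb[OF 1(1)]
    using moeb_scalar[OF 1(1)] by (simp add: algebra_simps)
  ultimately show "\<exists>B \<in> carrier PGL2. B \<otimes>\<^bsub>PGL2\<^esub> A = \<one>\<^bsub>PGL2\<^esub>" by (auto simp: PGL2_simps)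
qed

section \<open>Equivalence of rational expressions\<close>

text \<open>Replaces the common orbit through some base point \<open>z\<close> by a direct relation
  between the two expressions. The inverse in the action disappears because \<open>A\<close> runs
  through the whole group.\<close>

lemma rat_equiv_iff:
  fixes R R' :: "'a::alg_closed_field poly fract"
  shows "rat_equiv R R' \<longleftrightarrow> nonconst R \<and>
    (\<exists>A \<in> carrier PGL2. \<exists>B \<in> carrier PGL2. R' = rat_comp B (rat_comp R A))"
proof -
  interpret group "PGL2 :: 'a poly fract monoid" by (rule group_PGL2)
  note [simp] = nonconst_PGL2 rat_comp_assoc nonconst_rat_comp rat_comp_X rat_comp_X_right
  note inv_simps = l_inv[unfolded PGL2_simps] r_inv[unfolded PGL2_simps]
  note closed = m_closed[unfolded PGL2_simps]
  have equiv: "rat_equiv R R' \<longleftrightarrow> (\<exists>z. nonconst z \<and>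
      (\<exists>A1 \<in> carrier PGL2. \<exists>B1 \<in> carrier PGL2. \<exists>A2 \<in> carrier PGL2. \<exists>B2 \<in> carrier PGL2.
        R = rat_comp B1 (rat_comp z (inv\<^bsub>PGL2\<^esub> A1)) \<and> R' = rat_comp B2 (rat_comp z (inv\<^bsub>PGL2\<^esub> A2))))"
    by (simp add: rat_equiv_def same_orbit_def orbits_def orbit_def rat_act_def
        rat_degree_pos_iff DirProd_def Bex_def) blast
  show ?thesis
  proof
    assume "rat_equiv R R'"
    then obtain z A1 B1 A2 B2 where z: "nonconst z"
      and c: "A1 \<in> carrier PGL2" "B1 \<in> carrier PGL2" "A2 \<in> carrier PGL2" "B2 \<in> carrier PGL2"
      and R: "R = rat_comp B1 (rat_comp z (inv\<^bsub>PGL2\<^esub> A1))"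
      and R': "R' = rat_comp B2 (rat_comp z (inv\<^bsub>PGL2\<^esub> A2))"
      unfolding equiv by blast
    \<comment> \<open>Undoing \<open>B1\<close> and \<open>A1\<close> expresses the base point
      \<open>z\<close> through \<open>R\<close>.\<close>
    have "rat_comp (inv\<^bsub>PGL2\<^esub> B1) R = rat_comp z (inv\<^bsub>PGL2\<^esub> A1)"
      unfolding R using z c
      by (subst rat_comp_assoc[symmetric]) (simp_all add: inv_simps)
    then have "rat_comp (rat_comp (inv\<^bsub>PGL2\<^esub> B1) R) A1 = z"
      using z c by (simp add: inv_simps)
    then have "R' = rat_comp B2 (rat_comp (rat_comp (rat_comp (inv\<^bsub>PGL2\<^esub> B1) R) A1) (inv\<^bsub>PGL2\<^esub> A2))"
      using R' by simp
    moreover have R_nc: "nonconst R" unfolding R using z c by simp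
    ultimately have "R' = rat_comp (rat_comp B2 (inv\<^bsub>PGL2\<^esub> B1))
        (rat_comp R (rat_comp A1 (inv\<^bsub>PGL2\<^esub> A2)))"
      using c by simp
    moreover have "rat_comp B2 (inv\<^bsub>PGL2\<^esub> B1) \<in> carrier PGL2"
      "rat_comp A1 (inv\<^bsub>PGL2\<^esub> A2) \<in> carrier PGL2"
      using c closed by simp_all
    ultimately show "nonconst R \<and>
      (\<exists>A \<in> carrier PGL2. \<exists>B \<in> carrier PGL2. R' = rat_comp B (rat_comp R A))"
      using R_nc by blast
  next
    assume "nonconst R \<and>
      (\<exists>A \<in> carrier PGL2. \<exists>B \<in> carrier PGL2. R' = rat_comp B (rat_comp R A))"
    then obtain A B where AB: "nonconst R" "A \<in> carrier PGL2" "B \<in> carrier PGL2"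
      "R' = rat_comp B (rat_comp R A)" by blast
    \<comment> \<open>\<open>R\<close> itself serves as the base point of the orbit.\<close>
    have "R = rat_comp rat_X (rat_comp R (inv\<^bsub>PGL2\<^esub> rat_X))"
      using AB(1) inv_one by (simp add: PGL2_simps)
    moreover have "R' = rat_comp B (rat_comp R (inv\<^bsub>PGL2\<^esub> (inv\<^bsub>PGL2\<^esub> A)))"
      using AB by simp
    moreover have "inv\<^bsub>PGL2\<^esub> A \<in> carrier PGL2" using AB by simp
    ultimately show "rat_equiv R R'" unfolding equiv using AB rat_X_in_PGL2 by blast
  qed
qed

lemma rat_equiv_sym: "rat_equiv R R' \<Longrightarrow> rat_equiv R' R"
  by (auto simp: rat_equiv_def same_orbit_def)

lemma rat_equiv_left:
  fixes R :: "'a::alg_closed_field poly fract"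
  assumes "nonconst R" "a * d - b * c \<noteq> 0"
  shows "rat_equiv R ((rc a * R + rc b) / (rc c * R + rc d))"
  unfolding rat_equiv_iff
  using assms
  by (intro conjI bexI[where x = "moeb a b c d"] bexI[where x = rat_X])
    (simp_all add: rat_comp_X_right rat_comp_moeb_left moeb_in_PGL2)

lemma rat_equiv_right:
  fixes R :: "'a::alg_closed_field poly fract"
  assumes "nonconst R" "A \<in> carrier PGL2"
  shows "rat_equiv R (rat_comp R A)"
  unfolding rat_equiv_iff
  using assms
  by (intro conjI bexI[where x = A] bexI[where x = rat_X])
    (simp_all add: rat_comp_X nonconst_rat_comp nonconst_PGL2)

lemma rat_equiv_trans [trans]:
  fixes R :: "'a::alg_closed_field poly fract"
  assumes 1: "rat_equiv R S" and 2: "rat_equiv S T"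
  shows "rat_equiv R T"
proof -
  interpret group "PGL2 :: 'a poly fract monoid" by (rule group_PGL2)
  note [simp] = nonconst_PGL2 rat_comp_assoc nonconst_rat_comp
  from 1 obtain A B where AB: "nonconst R" "A \<in> carrier PGL2" "B \<in> carrier PGL2"
    "S = rat_comp B (rat_comp R A)" by (auto simp: rat_equiv_iff)
  from 2 obtain A' B' where AB': "A' \<in> carrier PGL2" "B' \<in> carrier PGL2"
    "T = rat_comp B' (rat_comp S A')" by (auto simp: rat_equiv_iff)
  have "T = rat_comp (rat_comp B' B) (rat_comp R (rat_comp A A'))"
    using AB AB' by simp
  then show ?thesis
    using AB AB' m_closed[unfolded PGL2_simps] unfolding rat_equiv_iff by blast
qed

section \<open>The invariant of a pencil of binary cubics\<close>

definition pluecker :: "'a::field poly \<Rightarrow> 'a poly \<Rightarrow> nat \<Rightarrow> nat \<Rightarrow> 'a" where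
  "pluecker g h i j = coeff g i * coeff h j - coeff g j * coeff h i"

text \<open>Three times the alternating form \<open>a0 b3 - a1 b2 / 3 + a2 b1 / 3 - a3 b0\<close>,
  the invariant pairing of binary cubics written in plain coefficients.\<close>

definition cubic_pairing :: "'a::field poly \<Rightarrow> 'a poly \<Rightarrow> 'a" where
  "cubic_pairing g h = 3 * pluecker g h 0 3 - pluecker g h 1 2"

text \<open>The Bezout determinant: the resultant of \<open>g\<close> and \<open>h\<close> as binary cubic forms, up to sign.\<close>

definition cubic_res :: "'a::field poly \<Rightarrow> 'a poly \<Rightarrow> 'a" where
  "cubic_res g h = (let p = pluecker g h in
     p 0 1 * ((p 0 3 + p 1 2) * p 2 3 - p 1 3 * p 1 3)
     - p 0 2 * (p 0 2 * p 2 3 - p 1 3 * p 0 3)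
     + p 0 3 * (p 0 2 * p 1 3 - (p 0 3 + p 1 2) * p 0 3))"

lemma coeff_pCons_small:
  "coeff (pCons a p) 1 = coeff p 0" "coeff (pCons a p) 2 = coeff p 1"
  "coeff (pCons a p) 3 = coeff p 2"
  by (simp_all add: eval_nat_numeral)

lemmas cubic_simps = cubic_res_def cubic_pairing_def pluecker_def Let_def coeff_pCons_small

lemma degree_quad_le: "degree [:a0, a1, a2, a3:] \<le> 3"
  by (simp add: degree_pCons_eq_if)

lemma degree_le_3_conv:
  "degree p \<le> 3 \<longleftrightarrow> p = [:coeff p 0, coeff p 1, coeff p 2, coeff p 3:]"
proof
  assume "degree p \<le> 3"
  then show "p = [:coeff p 0, coeff p 1, coeff p 2, coeff p 3:]"
    by (intro poly_eqI) (auto simp: coeff_pCons coeff_eq_0 eval_nat_numeral split: nat.splits)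
next
  assume *: "p = [:coeff p 0, coeff p 1, coeff p 2, coeff p 3:]"
  show "degree p \<le> 3" by (subst *) (rule degree_quad_le)
qed

lemma degree_le_3E:
  assumes "degree p \<le> 3"
  obtains a0 a1 a2 a3 where "p = [:a0, a1, a2, a3:]"
  using assms degree_le_3_conv by blast

text \<open>The determinant vanishes on proportional pairs, so a nonzero value certifies a genuine
  nonconstant fraction.\<close>

lemma cubic_res_nz:
  assumes "cubic_res g h \<noteq> 0"
  shows "nonconst (Fract g h)" "h \<noteq> 0"
proof -
  show h: "h \<noteq> 0" using assms by (auto simp: cubic_simps)
  have "cubic_res (smult k h) h = 0" for k by (simp add: cubic_simps)
  then show "nonconst (Fract g h)"
    using assms h by (auto simp: nonconst_def rc_def eq_fract)
qed

lemma pluecker_lin: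
  "pluecker (smult a g + smult b h) (smult c g + smult d h) i j = (a * d - b * c) * pluecker g h i j"
  by (simp add: pluecker_def algebra_simps)

text \<open>A change of basis of the pencil multiplies every minor by its determinant, and the
  Bezout determinant is a cubic form in the minors.\<close>

lemma cubic_res_lin:
  "cubic_res (smult a g + smult b h) (smult c g + smult d h) = (a * d - b * c) ^ 3 * cubic_res g h"
  unfolding cubic_res_def Let_def pluecker_lin by algebra

lemma cubic_pairing_lin:
  "cubic_pairing (smult a g + smult b h) (smult c g + smult d h) = (a * d - b * c) * cubic_pairing g h"
  unfolding cubic_pairing_def pluecker_lin by algebra

lemma moeb_Fract:
  fixes g h :: "'a::alg_closed_field poly"
  assumes "h \<noteq> 0" "nonconst (Fract g h)"
  shows "rat_comp (moeb a b c d) (Fract g h) = Fract (smult a g + smult b h) (smult c g + smult d h)"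
proof -
  have "ev rat_X h \<noteq> 0" using assms(1) by (simp add: ev_eq_0_iff)
  then show ?thesis unfolding rat_comp_moeb_left[OF assms(2)]
    by (simp add: Fract_conv divide_simps)
qed

section \<open>Affine substitutions and inversion of the variable\<close>

lemma pcompose_cubic:
  "pcompose [:a0, a1, a2, a3:] [:v, u:] =
    [:a0 + a1 * v + a2 * v ^ 2 + a3 * v ^ 3, u * (a1 + 2 * a2 * v + 3 * a3 * v ^ 2),
      u ^ 2 * (a2 + 3 * a3 * v), u ^ 3 * a3:]"
  for a0 :: "'a::field"
  by (simp add: pcompose_pCons algebra_simps power2_eq_square power3_eq_cube)

lemma ev_pcompose: "ev (ev T p) g = ev T (pcompose g p)"
  by (induction g) (simp_all add: pcompose_pCons)

lemma Fract_affine: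
  fixes g h :: "'a::alg_closed_field poly"
  assumes "u \<noteq> 0"
  shows "rat_comp (Fract g h) (moeb u v 0 1) = Fract (pcompose g [:v, u:]) (pcompose h [:v, u:])"
proof -
  have "nonconst (moeb u v 0 1)" using assms by (intro nonconst_moeb) simp
  moreover have "moeb u v 0 1 = ev rat_X [:v, u:]"
    by (simp add: moeb_eq algebra_simps)
  ultimately show ?thesis
    by (subst rat_comp_Fract) (simp_all only: ev_pcompose Fract_conv)
qed

text \<open>The substitution acts linearly on the six minors. The pairing and the Bezout determinant
  are built from these alone, so their invariance can be checked on the minors.\<close>

lemma pluecker_affine:
  fixes a0 a1 a2 a3 b0 b1 b2 b3 u v :: "'a::field"
  defines "g \<equiv> [:a0, a1, a2, a3:]" and "h \<equiv> [:b0, b1, b2, b3:]"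
  defines "p \<equiv> pluecker g h" and "q \<equiv> pluecker (pcompose g [:v, u:]) (pcompose h [:v, u:])"
  shows "q 0 1 = u * (p 0 1 + 2 * v * p 0 2 + v ^ 2 * (3 * p 0 3 + p 1 2) + 2 * v ^ 3 * p 1 3
      + v ^ 4 * p 2 3)"
    and "q 0 2 = u ^ 2 * (p 0 2 + v * (3 * p 0 3 + p 1 2) + 3 * v ^ 2 * p 1 3 + 2 * v ^ 3 * p 2 3)"
    and "q 0 3 = u ^ 3 * (p 0 3 + v * p 1 3 + v ^ 2 * p 2 3)"
    and "q 1 2 = u ^ 3 * (p 1 2 + 3 * v * p 1 3 + 3 * v ^ 2 * p 2 3)"
    and "q 1 3 = u ^ 4 * (p 1 3 + 2 * v * p 2 3)"
    and "q 2 3 = u ^ 5 * p 2 3"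
  unfolding p_def q_def g_def h_def pcompose_cubic
  by (simp_all add: pluecker_def coeff_pCons_small algebra_simps eval_nat_numeral)

text \<open>The identity behind \<open>cubic_res_affine\<close>, in six scalars standing for the
  minors instead of the eight coefficients, which keeps the expansion smaller.\<close>

lemma bezout_det_affine:
  fixes u v p q r s t w :: "'a::field"
  assumes
    "p' = u * (p + 2 * v * q + v ^ 2 * (3 * r + s) + 2 * v ^ 3 * t + v ^ 4 * w)"
    and "q' = u ^ 2 * (q + v * (3 * r + s) + 3 * v ^ 2 * t + 2 * v ^ 3 * w)"
    and "r' = u ^ 3 * (r + v * t + v ^ 2 * w)"
    and "s' = u ^ 3 * (s + 3 * v * t + 3 * v ^ 2 * w)"
    and "t' = u ^ 4 * (t + 2 * v * w)"
    and "w' = u ^ 5 * w"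
  shows "p' * ((r' + s') * w' - t' * t') - q' * (q' * w' - t' * r') + r' * (q' * t' - (r' + s') * r')
  = u^9*(p * ((r + s) * w - t * t) - q * (q * w - t * r) + r * (q * t - (r + s) * r))"
  unfolding assms by (simp add: algebra_simps power2_eq_square eval_nat_numeral)

lemma cubic_res_affine:
  "cubic_res (pcompose [:a0, a1, a2, a3:] [:v, u:]) (pcompose [:b0, b1, b2, b3:] [:v, u:])
    = u ^ 9 * cubic_res [:a0, a1, a2, a3:] [:b0, b1, b2, b3:]"
  for a0 :: "'a::field"
  unfolding cubic_res_def Let_def by (rule bezout_det_affine[OF pluecker_affine])

lemma cubic_pairing_affine:
  "cubic_pairing (pcompose [:a0, a1, a2, a3:] [:v, u:]) (pcompose [:b0, b1, b2, b3:] [:v, u:])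
    = u ^ 3 * cubic_pairing [:a0, a1, a2, a3:] [:b0, b1, b2, b3:]"
  for a0 :: "'a::field"
  unfolding cubic_pairing_def pluecker_affine by algebra

text \<open>Inverting the variable reverses the coefficients of both cubic forms; the common factor
  \<open>x^3\<close> cancels.\<close>

lemma Fract_reverse:
  fixes a0 :: "'a::alg_closed_field"
  shows "rat_comp (Fract [:a0, a1, a2, a3:] [:b0, b1, b2, b3:]) (moeb 0 1 1 0) =
    Fract [:a3, a2, a1, a0:] [:b3, b2, b1, b0:]"
proof -
  have nc: "nonconst (moeb 0 1 1 0 :: 'a poly fract)" by (intro nonconst_moeb) simp
  have "moeb 0 1 1 0 = 1 / (rat_X :: 'a poly fract)" by (simp add: moeb_eq)
  moreover have "rat_X \<noteq> (0 :: 'a poly fract)" using nonconst_X by (metis nonconst_def rc_0)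
  moreover have "ev (1 / rat_X) [:c0, c1, c2, c3:] = ev rat_X [:c3, c2, c1, c0:] / rat_X ^ 3"
    if "rat_X \<noteq> (0 :: 'a poly fract)" for c0 c1 c2 c3 :: 'a
    using that by (simp add: field_simps power3_eq_cube)
  ultimately show ?thesis
    unfolding rat_comp_Fract[OF nc] Fract_conv[of "[:a3, a2, a1, a0:]"]
    by (simp del: ev_pCons)
qed

text \<open>Inversion of the variable has determinant -1. The determinant and the pairing have the
  odd weights 9 and 3, so both change sign.\<close>

lemma cubic_res_reverse:
  "cubic_res [:a3, a2, a1, a0:] [:b3, b2, b1, b0:] = - cubic_res [:a0, a1, a2, a3:] [:b0, b1, b2, b3:]"
  by (simp add: cubic_simps) algebra

lemma cubic_pairing_reverse:
  "cubic_pairing [:a3, a2, a1, a0:] [:b3, b2, b1, b0:]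
    = - cubic_pairing [:a0, a1, a2, a3:] [:b0, b1, b2, b3:]"
  by (simp add: cubic_simps)

section \<open>The invariant of a rational expression\<close>

text \<open>Says that \<open>P^3 / D\<close> equals \<open>j\<close>, without a division and for
  some representing pair of cubic forms. Such pairs are easy to transport along the group; that the
  choice of pair does not matter is \<open>cubic_inv_unique\<close>.\<close>

definition cubic_inv :: "'a::field \<Rightarrow> 'a poly fract \<Rightarrow> bool" where
  "cubic_inv j R \<longleftrightarrow> (\<exists>g h. R = Fract g h \<and> degree g \<le> 3 \<and> degree h \<le> 3 \<and>
     cubic_res g h \<noteq> 0 \<and> cubic_pairing g h ^ 3 = j * cubic_res g h)"

lemma cubic_inv_moeb:
  fixes R :: "'a::alg_closed_field poly fract"
  assumes "cubic_inv j R" "A \<in> carrier PGL2"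
  shows "cubic_inv j (rat_comp A R)"
proof -
  obtain g h where R: "R = Fract g h" "degree g \<le> 3" "degree h \<le> 3"
    "cubic_res g h \<noteq> 0" "cubic_pairing g h ^ 3 = j * cubic_res g h"
    using assms(1) by (auto simp: cubic_inv_def)
  obtain a b c d where A: "a * d - b * c \<noteq> 0" "A = moeb a b c d"
    using assms(2) PGL2_iff by blast
  show ?thesis unfolding cubic_inv_def
  proof (intro exI conjI)
    show "rat_comp A R = Fract (smult a g + smult b h) (smult c g + smult d h)"
      unfolding A(2) R(1) using R(4) cubic_res_nz by (intro moeb_Fract)
    show "degree (smult a g + smult b h) \<le> 3" "degree (smult c g + smult d h) \<le> 3"
      using R by (auto intro!: degree_add_le order.trans[OF degree_smult_le])
    show "cubic_res (smult a g + smult b h) (smult c g + smult d h) \<noteq> 0"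
      using A(1) R(4) by (simp add: cubic_res_lin)
    show "cubic_pairing (smult a g + smult b h) (smult c g + smult d h) ^ 3 =
        j * cubic_res (smult a g + smult b h) (smult c g + smult d h)"
      by (simp add: cubic_res_lin cubic_pairing_lin power_mult_distrib R(5))
  qed
qed

lemma cubic_inv_affine:
  fixes R :: "'a::alg_closed_field poly fract"
  assumes "cubic_inv j R" "u \<noteq> 0"
  shows "cubic_inv j (rat_comp R (moeb u v 0 1))"
proof -
  obtain g h where R: "R = Fract g h" "degree g \<le> 3" "degree h \<le> 3"
    "cubic_res g h \<noteq> 0" "cubic_pairing g h ^ 3 = j * cubic_res g h"
    using assms(1) by (auto simp: cubic_inv_def)
  obtain a0 a1 a2 a3 where g: "g = [:a0, a1, a2, a3:]" using R(2) by (rule degree_le_3E)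
  obtain b0 b1 b2 b3 where h: "h = [:b0, b1, b2, b3:]" using R(3) by (rule degree_le_3E)
  let ?g = "pcompose g [:v, u:]" and ?h = "pcompose h [:v, u:]"
  \<comment> \<open>The scaling factors agree: the pairing contributes \<open>(u^3)^3\<close> and
    the determinant \<open>u^9\<close>.\<close>
  have "cubic_pairing ?g ?h ^ 3 = j * cubic_res ?g ?h"
    using R(5) unfolding g h cubic_res_affine cubic_pairing_affine
    by (simp add: power_mult_distrib flip: power_mult)
  moreover have "cubic_res ?g ?h \<noteq> 0"
    using R(4) assms(2) unfolding g h cubic_res_affine by simp
  moreover have "degree ?g \<le> 3" "degree ?h \<le> 3"
    using R(2,3) assms(2) by (simp_all add: degree_pcompose)
  ultimately show ?thesis unfolding cubic_inv_def R(1) Fract_affine[OF assms(2)] by blast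
qed

lemma cubic_inv_reverse:
  fixes R :: "'a::alg_closed_field poly fract"
  assumes "cubic_inv j R"
  shows "cubic_inv j (rat_comp R (moeb 0 1 1 0))"
proof -
  obtain g h where R: "R = Fract g h" "degree g \<le> 3" "degree h \<le> 3"
    "cubic_res g h \<noteq> 0" "cubic_pairing g h ^ 3 = j * cubic_res g h"
    using assms(1) by (auto simp: cubic_inv_def)
  obtain a0 a1 a2 a3 where g: "g = [:a0, a1, a2, a3:]" using R(2) by (rule degree_le_3E)
  obtain b0 b1 b2 b3 where h: "h = [:b0, b1, b2, b3:]" using R(3) by (rule degree_le_3E)
  let ?g = "[:a3, a2, a1, a0:]" and ?h = "[:b3, b2, b1, b0:]"
  note eqs = cubic_res_reverse[of a3 a2 a1 a0 b3 b2 b1 b0] cubic_pairing_reverse[of a3 a2 a1 a0 b3 b2 b1 b0]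
  have "cubic_pairing ?g ?h ^ 3 = j * cubic_res ?g ?h"
    using R(5) unfolding g h eqs by simp
  moreover have "cubic_res ?g ?h \<noteq> 0"
    using R(4) unfolding g h eqs by simp
  ultimately show ?thesis
    unfolding cubic_inv_def R(1) unfolding g h Fract_reverse using degree_quad_le by blast
qed

text \<open>Together with the affine maps, inversion generates the group, so invariance need only be checked
  for these two kinds of maps.\<close>

lemma moeb_decompose:
  fixes a b c d :: "'a::alg_closed_field"
  assumes "a * d - b * c \<noteq> 0" "c \<noteq> 0"
  shows "moeb a b c d = rat_comp (moeb ((b * c - a * d) / c ^ 2) (a / c) 0 1)
    (rat_comp (moeb 0 1 1 0) (moeb 1 (d / c) 0 1))"
proof -
  let ?u = "(b * c - a * d) / c ^ 2"
  have "rat_comp (moeb 0 1 1 0) (moeb 1 (d / c) 0 1) = moeb 0 1 1 (d / c)"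
    by (subst rat_comp_moeb) simp_all
  moreover have "rat_comp (moeb ?u (a / c) 0 1) (moeb 0 1 1 (d / c))
      = moeb (a / c) (?u + a / c * (d / c)) 1 (d / c)"
    by (subst rat_comp_moeb) simp_all
  moreover have "?u + a / c * (d / c) = b / c"
    using assms(2) by (simp add: field_simps power2_eq_square)
  moreover have "moeb (a / c) (b / c) 1 (d / c) = moeb a b c d"
    using assms(2) unfolding moeb_def by (subst eq_fract) (simp_all add: field_simps)
  ultimately show ?thesis by simp
qed

lemma cubic_inv_right:
  fixes R :: "'a::alg_closed_field poly fract"
  assumes "cubic_inv j R" "A \<in> carrier PGL2"
  shows "cubic_inv j (rat_comp R A)"
proof -
  obtain a b c d where A: "a * d - b * c \<noteq> 0" "A = moeb a b c d"
    using assms(2) PGL2_iff by blast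
  show ?thesis
  proof (cases "c = 0")
    case True
    then have "A = moeb (a / d) (b / d) 0 1" "a / d \<noteq> 0"
      using A by (auto simp: moeb_eq add_divide_distrib)
    then show ?thesis using cubic_inv_affine[OF assms(1)] by metis
  next
    case False
    let ?u = "(b * c - a * d) / c ^ 2"
    have u: "?u \<noteq> 0" using A(1) False by simp
    have nc: "nonconst (moeb ?u (a / c) 0 1)" "nonconst (moeb 0 1 1 0 :: 'a poly fract)"
      "nonconst (moeb 1 (d / c) 0 1)"
      using u by (auto intro!: nonconst_moeb)
    have "rat_comp R A =
      rat_comp (rat_comp (rat_comp R (moeb ?u (a / c) 0 1)) (moeb 0 1 1 0)) (moeb 1 (d / c) 0 1)"
      unfolding A(2) moeb_decompose[OF A(1) False]
      using nc by (simp add: rat_comp_assoc nonconst_rat_comp)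
    then show ?thesis
      using cubic_inv_affine[OF cubic_inv_reverse[OF cubic_inv_affine[OF assms(1) u]]] by simp
  qed
qed

lemma cubic_inv_rat_equiv:
  fixes R :: "'a::alg_closed_field poly fract"
  assumes "cubic_inv j R" "rat_equiv R R'"
  shows "cubic_inv j R'"
  using assms unfolding rat_equiv_iff by (metis cubic_inv_moeb cubic_inv_right)

text \<open>A Bezout relation for the coprime pair, combined with \<open>G h = g H\<close>, shows
  that \<open>h\<close> divides \<open>H\<close>; the quotient is the common factor.\<close>

lemma Fract_lowest_terms:
  fixes G H :: "'a::field poly"
  assumes "coprime g h" "h \<noteq> 0" "H \<noteq> 0" "Fract G H = Fract g h"
  obtains k where "k \<noteq> 0" "G = k * g" "H = k * h"
proof -
  have eq: "G * h = g * H" using assms by (simp add: eq_fract)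
  obtain u v d where d: "d = u * g + v * h" "d dvd g" "d dvd h"
    by (rule poly_bezout[OF assms(2)])
  then have "is_unit d" using assms(1) by (meson coprime_common_divisor)
  then obtain e where e: "1 = d * e" by (elim dvdE)
  have "H = d * e * H" using e by simp
  also have "\<dots> = e * (u * (g * H) + v * h * H)" by (simp add: d algebra_simps)
  also have "\<dots> = (e * (u * G + v * H)) * h"
    unfolding eq[symmetric] by (simp add: algebra_simps)
  finally obtain k where k: "H = k * h" by blast
  then have "G * h = (k * g) * h" using eq by (simp add: algebra_simps)
  then have "G = k * g" using assms(2) by simp
  with k assms(3) that show ?thesis by auto
qed

text \<open>In a pair of forms of degree at most three the common factor over the lowest terms of a
  cubic expression can only be a scalar \<open>l\<close>, and it multiplies both \<open>P^3\<close>
  and \<open>D\<close> by \<open>l^6\<close>.\<close>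

lemma cubic_inv_unique:
  fixes g h :: "'a::field poly"
  assumes "cubic_inv j (Fract g h)" "coprime g h" "h \<noteq> 0" "max (degree g) (degree h) = 3"
  shows "cubic_pairing g h ^ 3 = j * cubic_res g h"
proof -
  obtain G H where GH: "Fract g h = Fract G H" "degree G \<le> 3" "degree H \<le> 3"
    "cubic_res G H \<noteq> 0" "cubic_pairing G H ^ 3 = j * cubic_res G H"
    using assms(1) by (auto simp: cubic_inv_def)
  obtain k where k: "k \<noteq> 0" "G = k * g" "H = k * h"
    using Fract_lowest_terms[OF assms(2,3) cubic_res_nz(2)[OF GH(4)] GH(1)[symmetric]] .
  have "degree k = 0"
  proof (cases "degree g = 3")
    case True
    then have "g \<noteq> 0" by auto
    then show ?thesis using GH(2) k True by (simp add: degree_mult_eq)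
  next
    case False
    then have "degree h = 3" using assms(4) by (auto simp: max_def split: if_splits)
    then show ?thesis using GH(3) k assms(3) by (simp add: degree_mult_eq)
  qed
  then obtain l where l: "k = [:l:]" by (elim degree_eq_zeroE)
  then have "l \<noteq> 0" and G: "G = smult l g + smult 0 h" and H: "H = smult 0 g + smult l h"
    using k by auto
  then show ?thesis
    using GH(5) unfolding G H cubic_res_lin cubic_pairing_lin
    by (simp add: power_mult_distrib)
qed

section \<open>Normal forms\<close>

lemma CHAR_neq_imp:
  assumes "CHAR('a::idom) \<noteq> p" "prime p"
  shows "(of_nat p :: 'a) \<noteq> 0"
  using assms CHAR_not_1' by (auto simp: of_nat_eq_0_iff_char_dvd prime_nat_iff)

lemma rat_equiv_refl:
  fixes R :: "'a::alg_closed_field poly fract"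
  shows "nonconst R \<Longrightarrow> rat_equiv R R"
  using rat_equiv_right[OF _ rat_X_in_PGL2] by (simp add: rat_comp_X_right)

lemma rat_equiv_lin:
  fixes g h :: "'a::alg_closed_field poly"
  assumes "cubic_res g h \<noteq> 0" "a * d - b * c \<noteq> 0"
  shows "rat_equiv (Fract g h) (Fract (smult a g + smult b h) (smult c g + smult d h))"
  using rat_equiv_left[OF cubic_res_nz(1)[OF assms(1)] assms(2)]
    moeb_Fract[OF cubic_res_nz(2)[OF assms(1)] cubic_res_nz(1)[OF assms(1)], of a b c d]
    rat_comp_moeb_left[OF cubic_res_nz(1)[OF assms(1)], of a b c d]
  by simp

lemma rat_equiv_affine:
  fixes g h :: "'a::alg_closed_field poly"
  assumes "cubic_res g h \<noteq> 0" "u \<noteq> 0"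
  shows "rat_equiv (Fract g h) (Fract (pcompose g [:v, u:]) (pcompose h [:v, u:]))"
  using rat_equiv_right[OF cubic_res_nz(1)[OF assms(1)] moeb_in_PGL2[of u 1 v 0]] assms(2)
  by (simp add: Fract_affine)

lemma rat_equiv_reverse:
  fixes a0 a1 a2 a3 b0 b1 b2 b3 :: "'a::alg_closed_field"
  assumes "cubic_res [:a0, a1, a2, a3:] [:b0, b1, b2, b3:] \<noteq> 0"
  shows "rat_equiv (Fract [:a0, a1, a2, a3:] [:b0, b1, b2, b3:])
    (Fract [:a3, a2, a1, a0:] [:b3, b2, b1, b0:])"
  using rat_equiv_right[OF cubic_res_nz(1)[OF assms(1)] moeb_in_PGL2[of 0 0 1 1]]
  by (simp add: Fract_reverse)

lemma cubic_res_low_degree: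
  "cubic_res [:0, 0, a, 1:] [:e, 1:] = e ^ 2 * (e - a)"
  "cubic_res [:a0, a1, a2, 1:] 1 = 1"
  by (simp_all add: cubic_simps algebra_simps power2_eq_square)

lemma pcompose_linear: "pcompose [:e, b:] [:v, u:] = [:e + b * v, b * u:]"
  for e :: "'a::field"
  by (simp add: pcompose_pCons mult.commute)

lemma Fract_smult: "l \<noteq> 0 \<Longrightarrow> Fract (smult l g) (smult l h) = Fract g h"
  for l :: "'a::field"
  by (simp add: Fract_conv)

section \<open>Reduction to normal form\<close>

definition standard :: "'a::field poly fract \<Rightarrow> bool" where
  "standard R \<longleftrightarrow> rat_equiv R (Fract [:0, 0, 0, 1:] 1) \<or>
    (\<exists>c. c \<notin> {0, 1} \<and> rat_equiv R (R_cubic c))"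

lemma standard_rat_equiv:
  fixes R :: "'a::alg_closed_field poly fract"
  shows "rat_equiv R S \<Longrightarrow> standard S \<Longrightarrow> standard R"
  unfolding standard_def using rat_equiv_trans by blast

text \<open>For \<open>c = 1 / 2\<close> the denominator is the constant
  \<open>- 1 / 2\<close>.\<close>

lemma R_cubic_half:
  assumes "(2 :: 'a::field) \<noteq> 0"
  shows "R_cubic (1 / 2 :: 'a) = Fract [:0, 0, 3, - 2:] 1"
proof -
  have "2 * (1 / 2 :: 'a) - 1 = 0" using assms by simp
  then show ?thesis using assms unfolding R_cubic_def by (simp add: eq_fract field_simps)
qed

text \<open>Infinity is totally ramified here. Moving a finite critical point and its value to 0
  leaves \<open>x^3 + e x^2\<close>, which is \<open>x^3\<close> or has a second finite critical
  point that can be moved to 1.\<close>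

lemma standard_poly:
  fixes a0 a1 a2 :: "'a::alg_closed_field"
  assumes "(2 :: 'a) \<noteq> 0" "(3 :: 'a) \<noteq> 0"
  shows "standard (Fract [:a0, a1, a2, 1:] 1)"
proof -
  have "degree [:a1, 2 * a2, 3:] \<noteq> 0" using assms by simp
  then obtain r where "poly [:a1, 2 * a2, 3:] r = 0" using alg_closed_imp_poly_has_root by blast
  then have r: "a1 + 2 * a2 * r + 3 * r ^ 2 = 0" by (simp add: algebra_simps power2_eq_square)
  let ?A = "a0 + a1 * r + a2 * r ^ 2 + r ^ 3" and ?e = "a2 + 3 * r"
  have 1: "rat_equiv (Fract [:a0, a1, a2, 1:] 1) (Fract [:?A, 0, ?e, 1:] 1)"
    using rat_equiv_affine[of "[:a0, a1, a2, 1:]" 1 1 r] r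
    by (simp add: cubic_res_low_degree pcompose_cubic pcompose_1)
  have 2: "rat_equiv (Fract [:?A, 0, ?e, 1:] 1) (Fract [:0, 0, ?e, 1:] 1)"
  proof -
    have "cubic_res [:?A, 0, ?e, 1:] 1 \<noteq> 0" by (simp add: cubic_res_low_degree)
    from rat_equiv_lin[OF this, of 1 1 "- ?A" 0] show ?thesis by (simp add: pCons_one)
  qed
  have "standard (Fract [:0, 0, e, 1:] 1)" for e :: 'a
  proof (cases "e = 0")
    case True
    have "rat_equiv (Fract [:0, 0, e, 1:] 1) (Fract [:0, 0, e, 1:] 1)"
      by (intro rat_equiv_refl cubic_res_nz) (simp add: cubic_res_low_degree)
    then show ?thesis unfolding standard_def True by blast
  next
    case False
    \<comment> \<open>\<open>u\<close> is the nonzero critical point of \<open>x^3 + e x^2\<close>;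
      rescaling moves it to 1, and the factor \<open>3 / (u^2 e)\<close> then makes its value
      1.\<close>
    define u where "u = - 2 * e / 3"
    have u: "u \<noteq> 0" using False assms by (simp add: u_def)
    have "rat_equiv (Fract [:0, 0, e, 1:] 1) (Fract [:0, 0, u ^ 2 * e, u ^ 3:] 1)"
      using rat_equiv_affine[of "[:0, 0, e, 1:]" 1 u 0] u
      by (simp add: cubic_res_low_degree pcompose_cubic pcompose_1)
    moreover have "rat_equiv (Fract [:0, 0, u ^ 2 * e, u ^ 3:] 1) (Fract [:0, 0, 3, - 2:] 1)"
    proof -
      have "cubic_res [:0, 0, u ^ 2 * e, u ^ 3:] 1 \<noteq> 0"
        using u by (simp add: cubic_simps)
      moreover have "3 / (u ^ 2 * e) * u ^ 3 = - 2"
        using False assms u by (simp add: field_simps power2_eq_square power3_eq_cube)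
          (simp add: u_def)
      ultimately show ?thesis
        using rat_equiv_lin[of "[:0, 0, u ^ 2 * e, u ^ 3:]" 1 "3 / (u ^ 2 * e)" 1 0 0] u False assms
        by (simp add: pCons_one)
    qed
    ultimately have "rat_equiv (Fract [:0, 0, e, 1:] 1) (R_cubic (1 / 2))"
      unfolding R_cubic_half[OF assms(1)] by (rule rat_equiv_trans)
    moreover have "(2 :: 'a) \<noteq> 1"
      by (metis add_cancel_right_right one_add_one zero_neq_one)
    then have "1 / 2 \<notin> {0, 1 :: 'a}" using assms(1) by (auto simp: field_simps)
    ultimately show ?thesis unfolding standard_def by blast
  qed
  then show ?thesis using 1 2 standard_rat_equiv by blast
qed

text \<open>Infinity is a pole of ramification index two. Two finite critical points are moved to 0
  and 1, their values likewise, and the criticality of the second fixes the denominator up to a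
  scalar.\<close>

lemma standard_linear_den:
  fixes a0 a1 a2 e :: "'a::alg_closed_field"
  assumes two: "(2 :: 'a) \<noteq> 0" and three: "(3 :: 'a) \<noteq> 0"
    and nz: "cubic_res [:a0, a1, a2, 1:] [:e, 1:] \<noteq> 0"
  shows "standard (Fract [:a0, a1, a2, 1:] [:e, 1:])"
proof -
  \<comment> \<open>the Wronskian of numerator and denominator\<close>
  have "degree [:a1 * e - a0, 2 * a2 * e, 3 * e + a2, 2:] \<noteq> 0" using two by simp
  then obtain r where "poly [:a1 * e - a0, 2 * a2 * e, 3 * e + a2, 2:] r = 0"
    using alg_closed_imp_poly_has_root by blast
  then have r: "a1 * e - a0 + 2 * a2 * e * r + (3 * e + a2) * r ^ 2 + 2 * r ^ 3 = 0"
    by (simp add: algebra_simps power2_eq_square power3_eq_cube)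
  define A0 A1 a E where "A0 = a0 + a1 * r + a2 * r ^ 2 + r ^ 3"
    and "A1 = a1 + 2 * a2 * r + 3 * r ^ 2" and "a = a2 + 3 * r" and "E = e + r"
  note defs = this
  have crit: "A0 = A1 * E" using r unfolding defs by algebra
  have 1: "rat_equiv (Fract [:a0, a1, a2, 1:] [:e, 1:]) (Fract [:A0, A1, a, 1:] [:E, 1:])"
    using rat_equiv_affine[OF nz, of 1 r]
    by (simp add: pcompose_cubic pcompose_linear defs)
  have nz1: "cubic_res [:A0, A1, a, 1:] [:E, 1:] \<noteq> 0"
    using nz cubic_res_affine[of a0 a1 a2 1 r 1 e 1 0 0]
    by (simp add: pcompose_cubic pcompose_linear defs)
  \<comment> \<open>Otherwise the numerator and the denominator would both be divisible by
    \<open>x\<close>.\<close>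
  have "E \<noteq> 0"
  proof
    assume "E = 0"
    with crit have "A0 = 0" by simp
    with nz1 \<open>E = 0\<close> show False by (simp add: cubic_simps)
  qed
  \<comment> \<open>By \<open>crit\<close> the value at 0 is \<open>A1\<close>; subtracting it
    removes the constant and the linear coefficient of the numerator at once.\<close>
  have 2: "rat_equiv (Fract [:A0, A1, a, 1:] [:E, 1:]) (Fract [:0, 0, a, 1:] [:E, 1:])"
    using rat_equiv_lin[OF nz1, of 1 1 "- A1" 0] crit by simp
  have nz2: "cubic_res [:0, 0, a, 1:] [:E, 1:] \<noteq> 0"
    using nz1 cubic_res_lin[of 1 "[:A0, A1, a, 1:]" "- A1" "[:E, 1:]" 0 1] crit by simp
  then have aE: "a \<noteq> E" by (auto simp: cubic_res_low_degree)
  \<comment> \<open>After the translation the Wronskian is \<open>x (2 x\<^sup>2 + (3 E + a) x + 2 a E)\<close>, and \<open>s\<close> is a second critical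
    point.\<close>
  obtain s where s: "s \<noteq> 0" "2 * s ^ 2 + (3 * E + a) * s + 2 * a * E = 0"
  proof (cases "a = 0")
    case True
    \<comment> \<open>The quadratic now has 0 as a root, so its other root is taken.\<close>
    define s where "s = - 3 * E / 2"
    have "2 * s = - 3 * E" using two by (simp add: s_def)
    then have "2 * s ^ 2 + (3 * E + a) * s + 2 * a * E = 0" using True by algebra
    moreover have "s \<noteq> 0" using two three \<open>E \<noteq> 0\<close> by (simp add: s_def)
    ultimately show ?thesis using that by blast
  next
    case False
    have "degree [:2 * a * E, 3 * E + a, 2:] \<noteq> 0" using two by simp
    then obtain s where "poly [:2 * a * E, 3 * E + a, 2:] s = 0"
      using alg_closed_imp_poly_has_root by blast
    then have "2 * s ^ 2 + (3 * E + a) * s + 2 * a * E = 0"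
      by (simp add: algebra_simps power2_eq_square)
    moreover from this have "s \<noteq> 0" using False two \<open>E \<noteq> 0\<close> by auto
    ultimately show ?thesis using that by blast
  qed
  \<comment> \<open>After scaling \<open>s\<close> to 1 the numerator is proportional to
    \<open>x^3 + (a / s) x^2\<close>, so \<open>a / s\<close> has to be \<open>c - 2\<close>. The
    equation for \<open>s\<close> then says that \<open>E\<close> and \<open>s\<close> are in the
    ratio of \<open>- c\<close> to \<open>2 c - 1\<close>.\<close>
  define c where "c = a / s + 2"
  have ca: "a = (c - 2) * s" using s(1) by (simp add: c_def)
  have "s * (s * c + E * (2 * c - 1)) = 2 * s ^ 2 + (3 * E + a) * s + 2 * a * E"
    unfolding ca by algebra
  then have cE: "s * c + E * (2 * c - 1) = 0" using s by simp
  have c0: "c \<noteq> 0" using cE \<open>E \<noteq> 0\<close> by auto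
  have c2: "2 * c - 1 \<noteq> 0" using cE s(1) c0 by auto
  have c1: "c \<noteq> 1"
  proof
    assume "c = 1"
    then have "a = E" using cE unfolding ca by (simp add: add_eq_0_iff)
    with aE show False by simp
  qed
  have nz3: "cubic_res [:0, 0, a * s ^ 2, s ^ 3:] [:E, s:] \<noteq> 0"
    using nz2 cubic_res_affine[of 0 0 a 1 0 s E 1 0 0] s(1)
    by (simp add: pcompose_cubic pcompose_linear mult.commute)
  \<comment> \<open>Scaling the values by \<open>k\<close> makes the numerator and the denominator
    the same multiple \<open>k s^3\<close> of those of \<open>R_cubic c\<close>.\<close>
  define k where "k = 1 / (s ^ 2 * (2 * c - 1))"
  have k: "k \<noteq> 0" "k * s ^ 3 * (2 * c - 1) = s"
    using s(1) c2 by (simp_all add: k_def field_simps power2_eq_square power3_eq_cube)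
  have ks: "k * s ^ 3 * (- c) = E"
  proof -
    have "(k * s ^ 3 * (- c)) * (2 * c - 1) = (k * s ^ 3 * (2 * c - 1)) * (- c)"
      by (simp only: ac_simps)
    also have "\<dots> = s * (- c)" unfolding k(2) ..
    also have "\<dots> = E * (2 * c - 1)" using cE by (simp add: add_eq_0_iff)
    finally show ?thesis using c2 mult_right_cancel by blast
  qed
  have "rat_equiv (Fract [:0, 0, a, 1:] [:E, 1:]) (Fract [:0, 0, a * s ^ 2, s ^ 3:] [:E, s:])"
    using rat_equiv_affine[OF nz2, of s 0] s(1)
    by (simp add: pcompose_cubic pcompose_linear mult.commute)
  also have "rat_equiv \<dots> (R_cubic c)"
  proof -
    have "rat_equiv (Fract [:0, 0, a * s ^ 2, s ^ 3:] [:E, s:])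
        (Fract [:0, 0, k * (a * s ^ 2), k * s ^ 3:] [:E, s:])"
      using rat_equiv_lin[OF nz3, of k 1 0 0] k(1) by simp
    moreover have "Fract [:0, 0, k * (a * s ^ 2), k * s ^ 3:] [:E, s:] = R_cubic c"
    proof -
      have "[:0, 0, k * (a * s ^ 2), k * s ^ 3:] = smult (k * s ^ 3) [:0, 0, c - 2, 1:]"
        by (simp add: ca power2_eq_square power3_eq_cube)
      moreover have "[:E, s:] = smult (k * s ^ 3) [:- c, 2 * c - 1:]"
        using ks k(2) by simp
      moreover have "k * s ^ 3 \<noteq> 0" using k(1) s(1) by simp
      ultimately show ?thesis unfolding R_cubic_def by (simp only: Fract_smult not_False_eq_True)
    qed
    ultimately show ?thesis by simp
  qed
  finally have "rat_equiv (Fract [:0, 0, a, 1:] [:E, 1:]) (R_cubic c)" .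
  with 1 2 have "rat_equiv (Fract [:a0, a1, a2, 1:] [:e, 1:]) (R_cubic c)"
    using rat_equiv_trans by blast
  then show ?thesis using c0 c1 unfolding standard_def by blast
qed

lemma standard_lower_den:
  fixes a0 a1 a2 a3 b0 b1 :: "'a::alg_closed_field"
  assumes two: "(2 :: 'a) \<noteq> 0" and three: "(3 :: 'a) \<noteq> 0"
    and nz: "cubic_res [:a0, a1, a2, a3:] [:b0, b1:] \<noteq> 0"
  shows "standard (Fract [:a0, a1, a2, a3:] [:b0, b1:])"
proof -
  have a3: "a3 \<noteq> 0" using nz by (auto simp: cubic_simps)
  have "b0 \<noteq> 0 \<or> b1 \<noteq> 0" using nz by (auto simp: cubic_simps)
  \<comment> \<open>\<open>d\<close> is the leading coefficient of the denominator; dividing by it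
    leaves 1 or a monic linear polynomial.\<close>
  then obtain d where d: "d \<noteq> 0" "b1 \<noteq> 0 \<Longrightarrow> d = b1" "b1 = 0 \<Longrightarrow> d = b0" by metis
  let ?g = "[:a0 / a3, a1 / a3, a2 / a3, 1:]" and ?h = "[:b0 / d, b1 / d:]"
  have 1: "rat_equiv (Fract [:a0, a1, a2, a3:] [:b0, b1:]) (Fract ?g ?h)"
    using rat_equiv_lin[OF nz, of "1 / a3" "1 / d" 0 0] a3 d(1) by simp
  have 2: "cubic_res ?g ?h \<noteq> 0"
    using cubic_res_lin[of "1 / a3" "[:a0, a1, a2, a3:]" 0 "[:b0, b1:]" 0 "1 / d"] nz a3 d(1)
    by simp
  show ?thesis
  proof (cases "b1 = 0")
    case True
    then have "?h = 1" using d by (simp add: pCons_one)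
    then have "standard (Fract ?g ?h)" using standard_poly[OF two three] by metis
    with 1 show ?thesis by (rule standard_rat_equiv)
  next
    case False
    then have "?h = [:b0 / d, 1:]" using d by simp
    then have "standard (Fract ?g ?h)" using standard_linear_den[OF two three] 2 by metis
    with 1 show ?thesis by (rule standard_rat_equiv)
  qed
qed

text \<open>The condition \<open>ram\<close> says that 0 is critical. Its value is sent to infinity
  unless it is there already, and inverting the variable moves the point itself to infinity; what
  remains is a denominator of degree at most one.\<close>

lemma standard_ramified_0:
  fixes a0 a1 a2 a3 b0 b1 b2 b3 :: "'a::alg_closed_field"
  assumes two: "(2 :: 'a) \<noteq> 0" and three: "(3 :: 'a) \<noteq> 0"
    and nz: "cubic_res [:a0, a1, a2, a3:] [:b0, b1, b2, b3:] \<noteq> 0"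
    and ram: "a0 * b1 = a1 * b0"
  shows "standard (Fract [:a0, a1, a2, a3:] [:b0, b1, b2, b3:])"
proof (cases "b0 = 0")
  case True
  then have "a0 \<noteq> 0" using nz by (auto simp: cubic_simps)
  then have "b1 = 0" using ram True by simp
  then have "cubic_res [:a3, a2, a1, a0:] [:b3, b2:] \<noteq> 0"
    using nz cubic_res_reverse[of a3 a2 a1 a0 b3 b2 0 0] True by simp
  then have "standard (Fract [:a3, a2, a1, a0:] [:b3, b2:])"
    by (rule standard_lower_den[OF two three])
  then show ?thesis
    using standard_rat_equiv[OF rat_equiv_reverse[OF nz]] True \<open>b1 = 0\<close> by simp
next
  case False
  let ?g = "[:b0, b1, b2, b3:]"
  let ?c = "b0 * a2 - a0 * b2" and ?d = "b0 * a3 - a0 * b3"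
  have 1: "rat_equiv (Fract [:a0, a1, a2, a3:] [:b0, b1, b2, b3:]) (Fract ?g [:0, 0, ?c, ?d:])"
    using rat_equiv_lin[OF nz, of 0 "- a0" 1 b0] False ram by (simp add: mult.commute)
  have 2: "cubic_res ?g [:0, 0, ?c, ?d:] \<noteq> 0"
    using cubic_res_lin[of 0 "[:a0, a1, a2, a3:]" 1 "[:b0, b1, b2, b3:]" b0 "- a0"] nz False ram
    by (simp add: mult.commute)
  have "cubic_res [:b3, b2, b1, b0:] [:?d, ?c:] \<noteq> 0"
    using 2 cubic_res_reverse[of b3 b2 b1 b0 ?d ?c 0 0] by simp
  then have "standard (Fract [:b3, b2, b1, b0:] [:?d, ?c:])"
    by (rule standard_lower_den[OF two three])
  then have "standard (Fract ?g [:0, 0, ?c, ?d:])"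
    using standard_rat_equiv[OF rat_equiv_reverse[OF 2]] by simp
  with 1 show ?thesis by (rule standard_rat_equiv)
qed

text \<open>The Wronskian is a binary quartic with leading coefficient \<open>a3 b2 - a2 b3\<close>.
  If this vanishes, infinity is critical and inversion moves it to 0; otherwise a finite root exists
  and is translated to 0.\<close>

lemma standard_cubic:
  fixes a0 a1 a2 a3 b0 b1 b2 b3 :: "'a::alg_closed_field"
  assumes two: "(2 :: 'a) \<noteq> 0" and three: "(3 :: 'a) \<noteq> 0"
    and nz: "cubic_res [:a0, a1, a2, a3:] [:b0, b1, b2, b3:] \<noteq> 0"
  shows "standard (Fract [:a0, a1, a2, a3:] [:b0, b1, b2, b3:])"
proof (cases "a3 * b2 = a2 * b3")
  case True
  have "cubic_res [:a3, a2, a1, a0:] [:b3, b2, b1, b0:] \<noteq> 0"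
    using nz cubic_res_reverse[of a3 a2 a1 a0 b3 b2 b1 b0] by simp
  then have "standard (Fract [:a3, a2, a1, a0:] [:b3, b2, b1, b0:])"
    using standard_ramified_0[OF two three] True by blast
  with rat_equiv_reverse[OF nz] show ?thesis by (rule standard_rat_equiv)
next
  case False
  \<comment> \<open>the Wronskian \<open>g' h - g h'\<close>\<close>
  define W where "W = [:a1 * b0 - a0 * b1, 2 * (a2 * b0 - a0 * b2),
    3 * (a3 * b0 - a0 * b3) + (a2 * b1 - a1 * b2), 2 * (a3 * b1 - a1 * b3), a3 * b2 - a2 * b3:]"
  have "degree W \<noteq> 0" using False by (simp add: W_def)
  then obtain r where r: "poly W r = 0" using alg_closed_imp_poly_has_root by blast
  let ?g = "pcompose [:a0, a1, a2, a3:] [:r, 1:]" and ?h = "pcompose [:b0, b1, b2, b3:] [:r, 1:]"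
  have "cubic_res ?g ?h \<noteq> 0" using nz by (simp add: cubic_res_affine)
  moreover have "coeff ?g 0 * coeff ?h 1 = coeff ?g 1 * coeff ?h 0"
  proof -
    have "coeff ?g 1 * coeff ?h 0 - coeff ?g 0 * coeff ?h 1 = poly W r"
      unfolding pcompose_cubic W_def coeff_pCons_small by simp algebra
    then show ?thesis using r by simp
  qed
  ultimately have "standard (Fract ?g ?h)"
    unfolding pcompose_cubic coeff_pCons_small coeff_pCons_0
    by (rule standard_ramified_0[OF two three])
  with rat_equiv_affine[OF nz, of 1 r] show ?thesis using standard_rat_equiv by simp
qed

section \<open>Nonvanishing of the resultant for coprime pairs\<close>

lemma linear_factor:
  fixes p :: "'a::alg_closed_field poly"
  assumes "degree p = Suc n"
  obtains r q where "p = [:- r, 1:] * q" "degree q = n"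
proof -
  obtain r where "poly p r = 0" using assms alg_closed_imp_poly_has_root[of p] by auto
  then obtain q where q: "p = [:- r, 1:] * q" by (auto simp: poly_eq_0_iff_dvd)
  moreover have "q \<noteq> 0" using assms q by auto
  ultimately have "degree p = Suc (degree q)" by (simp add: degree_mult_eq del: mult_pCons_left)
  with q that assms show ?thesis by simp
qed

text \<open>The product formula for the resultant over the roots of the second polynomial. Each
  degree by which it falls short of three counts as a root at infinity and contributes a factor
  \<open>a3\<close>.\<close>

lemma cubic_res_factored:
  fixes a0 a1 a2 a3 b r s t :: "'a::field"
  defines "g \<equiv> [:a0, a1, a2, a3:]"
  shows "cubic_res g [:b:] = b ^ 3 * a3 ^ 3"
    and "cubic_res g ([:- r, 1:] * [:b:]) = - (b ^ 3) * a3 ^ 2 * poly g r"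
    and "cubic_res g ([:- r, 1:] * ([:- s, 1:] * [:b:])) = b ^ 3 * a3 * poly g r * poly g s"
    and "cubic_res g ([:- r, 1:] * ([:- s, 1:] * ([:- t, 1:] * [:b:])))
      = - (b ^ 3) * poly g r * poly g s * poly g t"
  unfolding g_def
  by (simp_all add: cubic_simps) algebra+

lemma cubic_res_coprime:
  fixes g h :: "'a::alg_closed_field poly"
  assumes cop: "coprime g h" and h: "h \<noteq> 0" and deg: "max (degree g) (degree h) = 3"
  shows "cubic_res g h \<noteq> 0"
proof -
  have "degree g \<le> 3" "degree h \<le> 3" using deg by linarith+
  then obtain a0 a1 a2 a3 where g: "g = [:a0, a1, a2, a3:]" by (elim degree_le_3E)
  have no_root: "poly g r \<noteq> 0" if "[:- r, 1:] dvd h" for r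
  proof
    assume "poly g r = 0"
    then have "[:- r, 1:] dvd g" by (simp add: poly_eq_0_iff_dvd)
    then have "is_unit [:- r, 1:]" using that cop coprime_common_divisor by blast
    then show False by (simp add: is_unit_iff_degree)
  qed
  \<comment> \<open>If \<open>h\<close> has lower degree, the degree three comes from
    \<open>g\<close>.\<close>
  have a3: "a3 \<noteq> 0" if "degree h < 3"
    using that deg g by (auto split: if_splits)
  consider "degree h = 0" | "degree h = Suc 0" | "degree h = Suc (Suc 0)" | "degree h = Suc (Suc (Suc 0))"
    using \<open>degree h \<le> 3\<close> by linarith
  then show ?thesis
  proof cases
    case 1
    then obtain b where "h = [:b:]" by (elim degree_eq_zeroE)
    then show ?thesis using h a3 1 unfolding g by (simp add: cubic_res_factored)
  next
    case 2
    then obtain r q where q: "h = [:- r, 1:] * q" "degree q = 0" by (rule linear_factor)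
    then obtain b where b: "q = [:b:]" by (elim degree_eq_zeroE)
    have "poly g r \<noteq> 0" using no_root unfolding q by (simp only: dvd_triv_left simp_thms)
    moreover have "b \<noteq> 0" using h q b by auto
    ultimately show ?thesis using a3 2 unfolding q b g cubic_res_factored by simp
  next
    case 3
    then obtain r q where q: "h = [:- r, 1:] * q" "degree q = Suc 0" by (rule linear_factor)
    obtain s q' where q': "q = [:- s, 1:] * q'" "degree q' = 0"
      using q(2) by (rule linear_factor)
    from this(2) obtain b where b: "q' = [:b:]" by (elim degree_eq_zeroE)
    have "[:- r, 1:] dvd h" "[:- s, 1:] dvd h" unfolding q q' by (simp_all only: dvd_triv_left dvd_mult)
    then have "poly g r \<noteq> 0" "poly g s \<noteq> 0" by (simp_all only: no_root not_False_eq_True)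
    moreover have "b \<noteq> 0" using h q q' b by auto
    ultimately show ?thesis using a3 3 unfolding q q' b g cubic_res_factored by simp
  next
    case 4
    then obtain r q where q: "h = [:- r, 1:] * q" "degree q = Suc (Suc 0)" by (rule linear_factor)
    obtain s q' where q': "q = [:- s, 1:] * q'" "degree q' = Suc 0"
      using q(2) by (rule linear_factor)
    obtain t q'' where q'': "q' = [:- t, 1:] * q''" "degree q'' = 0"
      using q'(2) by (rule linear_factor)
    from this(2) obtain b where b: "q'' = [:b:]" by (elim degree_eq_zeroE)
    have "[:- r, 1:] dvd h" "[:- s, 1:] dvd h" "[:- t, 1:] dvd h"
      unfolding q q' q'' by (simp_all only: dvd_triv_left dvd_mult)
    then have "poly g r \<noteq> 0" "poly g s \<noteq> 0" "poly g t \<noteq> 0"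
      by (simp_all only: no_root not_False_eq_True)
    moreover have "b \<noteq> 0" using h q q' q'' b by auto
    ultimately show ?thesis unfolding q q' q'' b g cubic_res_factored by simp
  qed
qed

lemma standard_degree_3:
  fixes R :: "'a::alg_closed_field poly fract"
  assumes two: "(2 :: 'a) \<noteq> 0" and three: "(3 :: 'a) \<noteq> 0" and deg: "rat_degree R = 3"
  shows "standard R"
proof -
  let ?g = "rat_num R" and ?h = "rat_den R"
  have deg': "max (degree ?g) (degree ?h) = 3" using deg by (simp add: rat_degree_def)
  then have "degree ?g \<le> 3" "degree ?h \<le> 3" by linarith+
  then obtain a0 a1 a2 a3 b0 b1 b2 b3
    where gh: "?g = [:a0, a1, a2, a3:]" "?h = [:b0, b1, b2, b3:]" by (metis degree_le_3E)
  have "cubic_res ?g ?h \<noteq> 0"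
    using rat_num_den(2,3)[of R] deg' by (intro cubic_res_coprime)
  then have "standard (Fract ?g ?h)"
    unfolding gh by (rule standard_cubic[OF two three])
  then show ?thesis using rat_num_den(1)[of R] by simp
qed

section \<open>Ramification and the orbits of the anharmonic group\<close>

lemma coprime_no_common_root:
  fixes g h :: "'a::alg_closed_field poly"
  assumes "h \<noteq> 0" and no_root: "\<And>r. poly h r = 0 \<Longrightarrow> poly g r \<noteq> 0"
  shows "coprime g h"
proof (rule coprimeI)
  fix p assume p: "p dvd g" "p dvd h"
  show "is_unit p"
  proof (rule ccontr)
    assume "\<not> is_unit p"
    moreover have "p \<noteq> 0" using assms(1) p by auto
    ultimately obtain r where "poly p r = 0"
      using is_unit_iff_degree alg_closed_imp_poly_has_root by blast
    then show False using no_root[of r] p by (auto elim!: dvdE)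
  qed
qed

lemma nonconst_Fract: "nonconst (Fract g h) \<Longrightarrow> h \<noteq> 0 \<Longrightarrow> g \<noteq> smult b h"
  by (auto simp: nonconst_def rc_def eq_fract)

context
  fixes g h :: "'a::field poly"
  assumes cop: "coprime g h" and h: "h \<noteq> 0"
begin

lemma rat_map_Fract_Aff:
  "rat_map (Fract g h) (Aff a) = (if poly h a = 0 then Infty else Aff (poly g a / poly h a))"
  using h by (simp add: rat_map_def rat_num_den_Fract[OF cop h])

lemma rat_map_Fract_Infty:
  "degree g > degree h \<Longrightarrow> rat_map (Fract g h) Infty = Infty"
  using h by (simp add: rat_map_def rat_num_den_Fract[OF cop h])

lemma ram_index_Fract_Infty:
  "degree g > degree h \<Longrightarrow> ram_index (Fract g h) Infty = degree g - degree h"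
  using h
  by (simp add: ram_index_def fibre_mult_def fibre_poly_def rat_map_Fract_Infty
      rat_num_den_Fract[OF cop h])

lemma order_gt_1_iff:
  fixes p :: "'a poly"
  assumes "p \<noteq> 0"
  shows "Polynomial.order a p > 1 \<longleftrightarrow> poly p a = 0 \<and> poly (pderiv p) a = 0"
proof -
  have "Polynomial.order a p > 1 \<longleftrightarrow> [:- a, 1:] ^ 2 dvd p"
    using assms order_divides[of a 2 p] by auto
  also have "\<dots> \<longleftrightarrow> poly p a = 0 \<and> poly (pderiv p) a = 0"
  proof (cases "poly p a = 0")
    case True
    then obtain q where q: "p = [:- a, 1:] * q" by (auto simp: poly_eq_0_iff_dvd)
    have "[:- a, 1:] ^ 2 dvd p \<longleftrightarrow> [:- a, 1:] dvd q"
      unfolding q power2_eq_square by (rule dvd_mult_cancel_left[THEN trans]) simp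
    also have "\<dots> \<longleftrightarrow> poly q a = 0" by (simp add: poly_eq_0_iff_dvd)
    also have "poly q a = poly (pderiv p) a" 
      unfolding q pderiv_mult by (simp add: pderiv_pCons del: mult_pCons_left)
    finally show ?thesis using True by simp
  next
    case False
    then show ?thesis by (metis poly_eq_0_iff_dvd power2_eq_square dvd_mult_left)
  qed
  finally show ?thesis .
qed

text \<open>Over a pole the fibre polynomial is \<open>h\<close> up to a scalar, and the Wronskian
  at \<open>a\<close> is \<open>- g(a) h'(a)\<close> with \<open>g(a)\<close> nonzero. Elsewhere the
  fibre polynomial is \<open>g - b h\<close> with \<open>b = g(a) / h(a)\<close>, up to a scalar,
  and the derivative of \<open>g - b h\<close> at \<open>a\<close> is the Wronskian divided by
  \<open>h(a)\<close>.\<close>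

lemma ram_index_Fract_Aff:
  assumes nc: "nonconst (Fract g h)"
  shows "ram_index (Fract g h) (Aff a) > 1 \<longleftrightarrow> poly (pderiv g * h - g * pderiv h) a = 0"
proof -
  define l where "l = inverse (lead_coeff h)"
  have l: "l \<noteq> 0" using h by (simp add: l_def)
  show ?thesis
  proof (cases "poly h a = 0")
    case True
    have "poly g a \<noteq> 0"
    proof
      assume "poly g a = 0"
      then have "is_unit [:- a, 1:]"
        using True cop coprime_common_divisor by (metis poly_eq_0_iff_dvd)
      then show False by (simp add: is_unit_iff_degree)
    qed
    have "ram_index (Fract g h) (Aff a) = Polynomial.order a (smult l h)"
      using True by (simp add: ram_index_def fibre_mult_def fibre_poly_def rat_map_Fract_Aff
          rat_num_den_Fract[OF cop h] l_def)
    then show ?thesis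
      using True \<open>poly g a \<noteq> 0\<close> l h by (simp add: order_gt_1_iff[unfolded One_nat_def] pderiv_smult)
  next
    case False
    let ?b = "poly g a / poly h a"
    have "g \<noteq> smult ?b h" using nc h nonconst_Fract by blast
    then have nz: "smult l (g - smult ?b h) \<noteq> 0" using l by simp
    have "ram_index (Fract g h) (Aff a) = Polynomial.order a (smult l (g - smult ?b h))"
      using False by (simp add: ram_index_def fibre_mult_def fibre_poly_def rat_map_Fract_Aff
          rat_num_den_Fract[OF cop h] l_def smult_diff_right mult.commute)
    moreover have "poly (smult l (g - smult ?b h)) a = 0" using False by simp
    ultimately show ?thesis
      using False l nz by (simp add: order_gt_1_iff[unfolded One_nat_def] pderiv_smult pderiv_diff field_simps)
  qed
qed

end

section \<open>Ramification and branch points of the family\<close>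

context
  fixes c :: "'a::alg_closed_field"
  assumes two: "(2 :: 'a) \<noteq> 0" and c0: "c \<noteq> 0" and c1: "c \<noteq> 1"
begin

lemma R_cubic_den_nz: "[:- c, 2 * c - 1:] \<noteq> 0"
  using c0 by simp

lemma R_cubic_coprime: "coprime [:0, 0, c - 2, 1:] [:- c, 2 * c - 1:]"
proof (rule coprime_no_common_root[OF R_cubic_den_nz])
  fix r assume "poly [:- c, 2 * c - 1:] r = 0"
  then have r: "(2 * c - 1) * r = c" by (simp add: algebra_simps)
  show "poly [:0, 0, c - 2, 1:] r \<noteq> 0"
  proof
    assume "poly [:0, 0, c - 2, 1:] r = 0"
    then have "r * (r * (r + c - 2)) = 0" by (simp add: algebra_simps)
    moreover have "r \<noteq> 0" using r c0 by auto
    ultimately have "r + c - 2 = 0" by simp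
    then have "r = 2 - c" by (simp add: algebra_simps)
    \<comment> \<open>A common root would have to be \<open>2 - c\<close>, but the denominator there
      is \<open>- 2 (c - 1)^2\<close>.\<close>
    moreover have "2 * ((c - 1) * (c - 1)) = c - (2 * c - 1) * (2 - c)" by algebra
    ultimately have "2 * ((c - 1) * (c - 1)) = 0" using r by simp
    then show False using two c1 by simp
  qed
qed

lemma cubic_res_R_cubic:
  "cubic_res [:0, 0, c - 2, 1:] [:- c, 2 * c - 1:] = - 2 * c ^ 2 * (c - 1) ^ 2"
  by (simp add: cubic_simps) algebra

lemma cubic_pairing_R_cubic:
  "cubic_pairing [:0, 0, c - 2, 1:] [:- c, 2 * c - 1:] = 2 * (c ^ 2 - c + 1)"
  by (simp add: cubic_simps) algebra

lemma cubic_res_R_cubic_nz: "cubic_res [:0, 0, c - 2, 1:] [:- c, 2 * c - 1:] \<noteq> 0"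
  using two c0 c1 by (simp add: cubic_res_R_cubic)

lemma nonconst_R_cubic: "nonconst (R_cubic c)"
  unfolding R_cubic_def using cubic_res_R_cubic_nz by (rule cubic_res_nz)

lemma degree_R_cubic: "rat_degree (R_cubic c) = 3"
  unfolding R_cubic_def by (simp add: rat_num_den_Fract[OF R_cubic_coprime R_cubic_den_nz])

lemma ram_index_R_cubic_Infty:
  "ram_index (R_cubic c) Infty = 3 - (if 2 * c - 1 = 0 then 0 else 1)"
  unfolding R_cubic_def by (subst ram_index_Fract_Infty[OF R_cubic_coprime R_cubic_den_nz]) auto

lemma R_cubic_Infty: "rat_map (R_cubic c) Infty = Infty"
  unfolding R_cubic_def by (rule rat_map_Fract_Infty[OF R_cubic_coprime R_cubic_den_nz]) auto

lemma R_cubic_Aff: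
  "rat_map (R_cubic c) (Aff a) = (if (2 * c - 1) * a = c then Infty
    else Aff (a ^ 2 * (a + c - 2) / ((2 * c - 1) * a - c)))"
  unfolding R_cubic_def rat_map_Fract_Aff[OF R_cubic_coprime R_cubic_den_nz]
  by (auto simp: algebra_simps power2_eq_square)

lemma ram_index_R_cubic_Aff:
  "ram_index (R_cubic c) (Aff a) > 1 \<longleftrightarrow> a = 0 \<or> a = 1 \<or> (2 * c - 1) * a = - c * (c - 2)"
proof -
  have wronskian: "poly (pderiv [:0, 0, c - 2, 1:] * [:- c, 2 * c - 1:]
      - [:0, 0, c - 2, 1:] * pderiv [:- c, 2 * c - 1:]) a
      = 2 * (a * ((a - 1) * ((2 * c - 1) * a + c * (c - 2))))"
    by (simp add: pderiv_pCons) algebra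
  have "ram_index (R_cubic c) (Aff a) > 1 \<longleftrightarrow>
      2 * (a * ((a - 1) * ((2 * c - 1) * a + c * (c - 2)))) = 0"
    unfolding R_cubic_def wronskian[symmetric]
    by (rule ram_index_Fract_Aff[OF R_cubic_coprime R_cubic_den_nz nonconst_R_cubic[unfolded R_cubic_def]])
  also have "\<dots> \<longleftrightarrow> a = 0 \<or> a = 1 \<or> (2 * c - 1) * a + c * (c - 2) = 0" using two by simp
  finally show ?thesis by (simp only: mult_minus_left eq_neg_iff_add_eq_0)
qed

lemma ramification_points_R_cubic:
  assumes three: "(3 :: 'a) \<noteq> 0"
  shows "ramification_points (R_cubic c) = {Infty, Aff 0, Aff 1, ram_lambda c}"
proof -
  have "P \<in> ramification_points (R_cubic c) \<longleftrightarrow> P \<in> {Infty, Aff 0, Aff 1, ram_lambda c}" for P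
  proof (cases P)
    case Infty
    then show ?thesis by (simp add: ramification_points_def ram_index_R_cubic_Infty)
  next
    case (Aff a)
    have "(2 * c - 1) * a = - c * (c - 2) \<longleftrightarrow> Aff a = ram_lambda c"
    proof (cases "2 * c - 1 = 0")
      case True
      \<comment> \<open>For \<open>2 c = 1\<close> the last factor of the Wronskian is the constant
        \<open>c (c - 2)\<close>. Characteristic different from three keeps it nonzero, so it yields
        no affine ramification point.\<close>
      have "c \<noteq> 2"
      proof
        assume "c = 2"
        with True have "(3 :: 'a) = 0" by simp
        with three show False by simp
      qed
      with True c0 show ?thesis by (simp add: ram_lambda_def)
    next
      case False
      then have "Aff a = ram_lambda c \<longleftrightarrow> a = - c * (c - 2) / (2 * c - 1)"
        by (simp only: ram_lambda_def if_False proj_line.inject)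
      also have "\<dots> \<longleftrightarrow> a * (2 * c - 1) = - c * (c - 2)"
        by (rule nonzero_eq_divide_eq[OF False])
      finally show ?thesis by (simp only: mult.commute)
    qed
    then show ?thesis
      using Aff ram_index_R_cubic_Aff[of a] by (auto simp: ramification_points_def)
  qed
  then show ?thesis by blast
qed

lemma R_cubic_ram_lambda: "rat_map (R_cubic c) (ram_lambda c) = branch_mu c"
proof (cases "2 * c - 1 = 0")
  case True
  then show ?thesis by (simp add: ram_lambda_def branch_mu_def R_cubic_Infty)
next
  case False
  define d where "d = 2 * c - 1"
  define L where "L = - c * (c - 2) / d"
  have d: "d \<noteq> 0" using False by (simp add: d_def)
  have L: "d * L = - c * (c - 2)" using d by (simp add: L_def)
  have den: "d * L - c = - c * (c - 1)" unfolding L by algebra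
  \<comment> \<open>The factor \<open>d^3\<close> clears the denominators of \<open>L\<close>, so
    that \<open>d L\<close> can be replaced by its polynomial value.\<close>
  have "d ^ 3 * (L ^ 2 * (L + c - 2)) = (d * L) ^ 2 * (d * L + d * (c - 2))" by algebra
  also have "\<dots> = (- c * (c - 2)) ^ 2 * (- c * (c - 2) + d * (c - 2))" unfolding L ..
  also have "\<dots> = (- c * (c - 2) ^ 3) * (- c * (c - 1))" unfolding d_def by algebra
  finally have "L ^ 2 * (L + c - 2) / (- c * (c - 1)) = - c * (c - 2) ^ 3 / d ^ 3"
    using d c0 c1 by (simp add: frac_eq_eq mult_ac)
  then have "L ^ 2 * (L + c - 2) / (d * L - c) = - c * (c - 2) ^ 3 / d ^ 3" unfolding den .
  moreover have "d * L \<noteq> c" using den c0 c1 by auto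
  ultimately have "rat_map (R_cubic c) (Aff L) = Aff (- c * (c - 2) ^ 3 / d ^ 3)"
    by (simp only: R_cubic_Aff if_False flip: d_def)
  then show ?thesis
    using False by (simp only: ram_lambda_def branch_mu_def if_False d_def L_def)
qed

lemma half_iff: "c = 1 / 2 \<longleftrightarrow> 2 * c - 1 = 0"
  using two by (auto simp: field_simps)

lemma distinct_ram_lambda:
  "distinct [Infty, Aff 0, Aff 1, ram_lambda c] \<longleftrightarrow> c \<notin> {1 / 2, 2, - 1}"
proof (cases "2 * c - 1 = 0")
  case True
  then show ?thesis using half_iff by (simp add: ram_lambda_def)
next
  case False
  define L where "L = - c * (c - 2) / (2 * c - 1)"
  have "- c * (c - 2) - (2 * c - 1) = - (c - 1) * (c + 1)" by algebra
  then have "L = 1 \<longleftrightarrow> - (c - 1) * (c + 1) = 0"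
    unfolding L_def using False by (metis divide_eq_1_iff eq_iff_diff_eq_0)
  then have "L = 1 \<longleftrightarrow> c = - 1" using c1 by (simp add: eq_neg_iff_add_eq_0)
  moreover have "L = 0 \<longleftrightarrow> c = 2" using False c0 by (simp add: L_def)
  moreover have "c \<noteq> 1 / 2" using False half_iff by blast
  moreover have "ram_lambda c = Aff L" using False by (simp only: ram_lambda_def if_False L_def)
  ultimately show ?thesis by auto
qed

text \<open>The numerator of \<open>mu - 1\<close> is \<open>- (c - 1) (c + 1)^3\<close> and that of
  \<open>lambda - 1\<close> is \<open>- (c - 1) (c + 1)\<close>, so branch points collide for the
  same \<open>c\<close> as ramification points.\<close>

lemma distinct_branch_mu:
  "distinct [Infty, Aff 0, Aff 1, branch_mu c] \<longleftrightarrow> c \<notin> {1 / 2, 2, - 1}"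
proof (cases "2 * c - 1 = 0")
  case True
  then show ?thesis using half_iff by (simp add: branch_mu_def)
next
  case False
  define M where "M = - c * (c - 2) ^ 3 / (2 * c - 1) ^ 3"
  have "- c * (c - 2) ^ 3 - (2 * c - 1) ^ 3 = - (c - 1) * (c + 1) ^ 3" by algebra
  then have "M = 1 \<longleftrightarrow> - (c - 1) * (c + 1) ^ 3 = 0"
    unfolding M_def using False by (metis divide_eq_1_iff eq_iff_diff_eq_0 power_eq_0_iff)
  then have "M = 1 \<longleftrightarrow> c = - 1" using c1 by (simp add: eq_neg_iff_add_eq_0)
  moreover have "M = 0 \<longleftrightarrow> c = 2" using False c0 by (simp add: M_def)
  moreover have "c \<noteq> 1 / 2" using False half_iff by blast
  moreover have "branch_mu c = Aff M" using False by (simp only: branch_mu_def if_False M_def)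
  ultimately show ?thesis by auto
qed

section \<open>Equivalences within the family\<close>

lemma R_cubic_equiv_reflect: "rat_equiv (R_cubic c) (R_cubic (1 - c))"
proof -
  let ?G = "pcompose [:0, 0, c - 2, 1:] [:1, - 1:]" and ?H = "pcompose [:- c, 2 * c - 1:] [:1, - 1:]"
  have nz: "cubic_res ?G ?H \<noteq> 0"
    using cubic_res_R_cubic_nz cubic_res_affine[of 0 0 "c - 2" 1 1 "- 1" "- c" "2 * c - 1" 0 0]
    by simp
  have "rat_equiv (R_cubic c) (Fract ?G ?H)"
    unfolding R_cubic_def by (rule rat_equiv_affine[OF cubic_res_R_cubic_nz]) simp
  also have "rat_equiv \<dots> (Fract (smult (- 1) ?G + smult 1 ?H) (smult 0 ?G + smult 1 ?H))"
    by (rule rat_equiv_lin[OF nz]) simp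
  also have "smult (- 1) ?G + smult 1 ?H = [:0, 0, 1 - c - 2, 1:]"
    by (simp add: pcompose_cubic pcompose_linear)
  also have "smult 0 ?G + smult 1 ?H = [:- (1 - c), 2 * (1 - c) - 1:]"
    by (simp add: pcompose_linear)
  finally show ?thesis by (simp add: R_cubic_def)
qed

lemma R_cubic_equiv_inverse: "rat_equiv (R_cubic c) (R_cubic (1 / c))"
proof -
  let ?G = "[:1, c - 2, 0, 0:]" and ?H = "[:0, 0, 2 * c - 1, - c:]"
  have nz: "cubic_res ?G ?H \<noteq> 0"
    using cubic_res_R_cubic_nz cubic_res_reverse[of 1 "c - 2" 0 0 0 0 "2 * c - 1" "- c"]
    by simp
  have "rat_equiv (R_cubic c) (Fract ?G ?H)"
    using rat_equiv_reverse[of 0 0 "c - 2" 1 "- c" "2 * c - 1" 0 0] cubic_res_R_cubic_nz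
    by (simp add: R_cubic_def)
  also have "rat_equiv \<dots> (Fract (smult 0 ?G + smult 1 ?H) (smult 1 ?G + smult 0 ?H))"
    by (rule rat_equiv_lin[OF nz]) simp
  also have "smult 0 ?G + smult 1 ?H = smult (- c) [:0, 0, 1 / c - 2, 1:]"
    using c0 by (simp add: field_simps)
  also have "smult 1 ?G + smult 0 ?H = smult (- c) [:- (1 / c), 2 * (1 / c) - 1:]"
    using c0 by (simp add: field_simps)
  also have "Fract (smult (- c) [:0, 0, 1 / c - 2, 1:]) (smult (- c) [:- (1 / c), 2 * (1 / c) - 1:])
      = R_cubic (1 / c)"
    unfolding R_cubic_def using c0 by (intro Fract_smult) simp
  finally show ?thesis .
qed

end

lemma R_cubic_equiv_imp_orbit:
  fixes c c' :: "'a::alg_closed_field"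
  assumes two: "(2 :: 'a) \<noteq> 0" and c: "c \<noteq> 0" "c \<noteq> 1" and c': "c' \<noteq> 0" "c' \<noteq> 1"
    and equiv: "rat_equiv (R_cubic c) (R_cubic c')"
  shows "c' \<in> {c, 1 / c, 1 - c, 1 / (1 - c), 1 - 1 / c, 1 - 1 / (1 - c)}"
proof -
  \<comment> \<open>The value of \<open>P^3 / D\<close> at \<open>R_cubic c\<close>; equivalence
    forces the same value at \<open>c'\<close>.\<close>
  define j where "j = (2 * (c ^ 2 - c + 1)) ^ 3 / (- 2 * c ^ 2 * (c - 1) ^ 2)"
  have j: "(2 * (c ^ 2 - c + 1)) ^ 3 = j * (- 2 * c ^ 2 * (c - 1) ^ 2)"
    using two c by (simp add: j_def)
  have "cubic_inv j (R_cubic c)"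
    unfolding cubic_inv_def R_cubic_def
    using cubic_res_R_cubic_nz[OF two c] j
    by (intro exI[of _ "[:0, 0, c - 2, 1:]"] exI[of _ "[:- c, 2 * c - 1:]"])
      (simp add: cubic_res_R_cubic[OF two c] cubic_pairing_R_cubic[OF two c])
  then have "cubic_inv j (R_cubic c')" using equiv by (rule cubic_inv_rat_equiv)
  then have j': "(2 * (c' ^ 2 - c' + 1)) ^ 3 = j * (- 2 * c' ^ 2 * (c' - 1) ^ 2)"
    unfolding R_cubic_def cubic_res_R_cubic[OF two c', symmetric]
      cubic_pairing_R_cubic[OF two c', symmetric]
    by (rule cubic_inv_unique[OF _ R_cubic_coprime[OF two c'] R_cubic_den_nz[OF two c']]) auto
  \<comment> \<open>The difference of the two invariants vanishes exactly on the six graphs \<open>c' = s(c)\<close> with \<open>s\<close> in \<open>S\<close>.\<close>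
  define P where "P = (c' - c) * (c * c' - 1) * (c' + c - 1) * (c' * (1 - c) - 1)
      * (c * c' - c + 1) * (c' * (c - 1) - c)"
  have "2 ^ 4 * P = (2 * (c ^ 2 - c + 1)) ^ 3 * (2 * c' ^ 2 * (c' - 1) ^ 2)
      - (2 * (c' ^ 2 - c' + 1)) ^ 3 * (2 * c ^ 2 * (c - 1) ^ 2)"
    unfolding P_def by algebra
  also have "\<dots> = 0" unfolding j j' by algebra
  finally have "P = 0" using two by (simp only: mult_eq_0_iff power_eq_0_iff) simp
  then have "c' - c = 0 \<or> c * c' - 1 = 0 \<or> c' + c - 1 = 0 \<or> c' * (1 - c) - 1 = 0
      \<or> c * c' - c + 1 = 0 \<or> c' * (c - 1) - c = 0"
    by (simp add: P_def)
  then show ?thesis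
    using c by (elim disjE) (auto simp: field_simps)
qed

section \<open>The action of \<open>S\<close> on the parameter\<close>

lemma rat_map_moeb:
  assumes "a * d - b * c \<noteq> 0" "c * w + d \<noteq> 0"
  shows "rat_map (moeb a b c d) (Aff w) = Aff ((a * w + b) / (c * w + d))"
proof -
  have "[:d, c:] \<noteq> 0" using assms by auto
  then show ?thesis using assms
    by (simp add: moeb_def rat_map_Fract_Aff[OF moeb_coprime] algebra_simps)
qed

lemma rat_map_moeb_eq_Aff:
  assumes "a * d - b * c \<noteq> 0" "rat_map (moeb a b c d) (Aff w) = Aff w'"
  shows "c * w + d \<noteq> 0"
proof
  assume "c * w + d = 0"
  moreover have "[:d, c:] \<noteq> 0" using assms by auto
  ultimately show False using assms
    by (simp add: moeb_def rat_map_Fract_Aff[OF moeb_coprime] algebra_simps)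
qed

text \<open>Only chains of affine points are treated. This suffices because elements of
  \<open>S\<close> keep the parameters outside \<open>{0, 1}\<close> affine.\<close>

lemma rat_map_comp:
  fixes A B :: "'a::alg_closed_field poly fract"
  assumes "A \<in> carrier PGL2" "B \<in> carrier PGL2"
    and A: "rat_map A (Aff u) = Aff v" and B: "rat_map B (Aff v) = Aff w"
  shows "rat_map (rat_comp B A) (Aff u) = Aff w"
proof -
  obtain a b c d where 1: "a * d - b * c \<noteq> 0" "A = moeb a b c d" using assms PGL2_iff by blast
  obtain a' b' c' d' where 2: "a' * d' - b' * c' \<noteq> 0" "B = moeb a' b' c' d'"
    using assms PGL2_iff by blast
  have nz: "c * u + d \<noteq> 0" using rat_map_moeb_eq_Aff 1 A by blast
  have nz': "c' * v + d' \<noteq> 0" using rat_map_moeb_eq_Aff 2 B by blast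
  have v: "v * (c * u + d) = a * u + b" using A nz rat_map_moeb[OF 1(1) nz] 1(2) by (auto simp: field_simps)
  have w: "w = (a' * v + b') / (c' * v + d')" using B rat_map_moeb[OF 2(1) nz'] 2(2) by simp
  have den: "(c' * a + d' * c) * u + (c' * b + d' * d) = (c' * v + d') * (c * u + d)"
    using v by algebra
  have num: "(a' * a + b' * c) * u + (a' * b + b' * d) = (a' * v + b') * (c * u + d)"
    using v by algebra
  have "(a' * a + b' * c) * (c' * b + d' * d) - (a' * b + b' * d) * (c' * a + d' * c)
      = (a' * d' - b' * c') * (a * d - b * c)" by algebra
  then have "(a' * a + b' * c) * (c' * b + d' * d) - (a' * b + b' * d) * (c' * a + d' * c) \<noteq> 0"
    using 1(1) 2(1) by simp
  then show ?thesis
    unfolding 1(2) 2(2) rat_comp_moeb[OF 1(1)]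
    using nz nz' by (subst rat_map_moeb) (simp_all add: den num w)
qed

abbreviation S_elements :: "'a::field poly fract set" where
  "S_elements \<equiv> generate PGL2 {Fract 1 [:0, 1:], Fract [:1, - 1:] 1}"

lemma S_generators:
  "Fract 1 [:0, 1:] = moeb 0 1 1 0" "Fract [:1, - 1:] 1 = moeb (- 1) 1 0 1"
  by (simp_all add: moeb_def pCons_one)

lemma S_elements_PGL2:
  fixes s :: "'a::alg_closed_field poly fract"
  shows "s \<in> S_elements \<Longrightarrow> s \<in> carrier PGL2"
  using group.generate_in_carrier[OF group_PGL2]
  by (metis S_generators insert_iff empty_iff subsetI moeb_in_PGL2 diff_zero mult_1 mult_1_right
      mult_zero_left neg_equal_0_iff_equal one_neq_zero diff_0)

lemma rat_map_S_generators:
  "w \<noteq> 0 \<Longrightarrow> rat_map (Fract 1 [:0, 1:]) (Aff w) = Aff (1 / w)"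
  "rat_map (Fract [:1, - 1:] 1) (Aff w) = Aff (1 - w)"
  for w :: "'a::field"
  unfolding S_generators by (subst rat_map_moeb; simp)+

lemma same_S_orbit_iff:
  "same_S_orbit c c' \<longleftrightarrow> (\<exists>z. z \<notin> {0, 1} \<and> (\<exists>s \<in> S_elements. \<exists>s' \<in> S_elements.
     Aff c = rat_map s (Aff z) \<and> Aff c' = rat_map s' (Aff z)))"
  by (simp add: same_S_orbit_def same_orbit_def orbits_def orbit_def anharmonic_group_def Bex_def)
    blast

lemma S_generator_equiv:
  fixes w :: "'a::alg_closed_field"
  assumes "(2 :: 'a) \<noteq> 0" "w \<notin> {0, 1}" "h \<in> {Fract 1 [:0, 1:], Fract [:1, - 1:] 1}"
  shows "\<exists>w'. w' \<notin> {0, 1} \<and> rat_map h (Aff w) = Aff w' \<and> rat_equiv (R_cubic w) (R_cubic w')"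
proof -
  have w: "w \<noteq> 0" "w \<noteq> 1" using assms by auto
  from assms(3) consider "h = Fract 1 [:0, 1:]" | "h = Fract [:1, - 1:] 1" by blast
  then show ?thesis
  proof cases
    case 1
    then show ?thesis
      using R_cubic_equiv_inverse[OF assms(1) w] w rat_map_S_generators(1)[OF w(1)]
      by (intro exI[of _ "1 / w"]) simp
  next
    case 2
    then show ?thesis
      using R_cubic_equiv_reflect[OF assms(1) w] w rat_map_S_generators(2)[of w]
      by (intro exI[of _ "1 - w"]) simp
  qed
qed

text \<open>Induction over words in the two generators. Carrying along that the image is affine and
  avoids 0 and 1 lets both the maps and the equivalences be chained.\<close>

lemma S_orbit_equiv:
  fixes s :: "'a::alg_closed_field poly fract"
  assumes two: "(2 :: 'a) \<noteq> 0" and "s \<in> S_elements" "w \<notin> {0, 1}"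
  shows "\<exists>w'. w' \<notin> {0, 1} \<and> rat_map s (Aff w) = Aff w' \<and> rat_equiv (R_cubic w) (R_cubic w')"
  using assms(2,3)
proof (induction s arbitrary: w rule: generate.induct)
  case one
  have "rat_map rat_X (Aff w) = Aff w"
    using rat_map_moeb[of 1 1 0 0 w] by (simp add: moeb_scalar)
  then show ?case
    using one nonconst_R_cubic[OF two] rat_equiv_refl by (auto simp: PGL2_simps)
next
  case (incl h)
  show ?case by (rule S_generator_equiv[OF two incl(2,1)])
next
  case (inv h)
  \<comment> \<open>Both generators are involutions, so inverses reduce to the case of
    generators.\<close>
  have "inv\<^bsub>PGL2\<^esub> h = h"
  proof -
    interpret group "PGL2 :: 'a poly fract monoid" by (rule group_PGL2)
    have "h \<in> carrier PGL2" by (intro S_elements_PGL2 generate.incl inv(1))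
    moreover have "rat_comp h h = rat_X"
      using inv(1) unfolding S_generators
      by (auto simp: rat_comp_moeb moeb_scalar)
    ultimately show ?thesis by (intro inv_equality) (simp_all add: PGL2_simps)
  qed
  then show ?case using S_generator_equiv[OF two inv(2,1)] by simp
next
  case (eng h1 h2)
  obtain w2 where 2: "w2 \<notin> {0, 1}" "rat_map h2 (Aff w) = Aff w2" "rat_equiv (R_cubic w) (R_cubic w2)"
    using eng.IH(2) eng.prems by blast
  obtain w1 where 1: "w1 \<notin> {0, 1}" "rat_map h1 (Aff w2) = Aff w1" "rat_equiv (R_cubic w2) (R_cubic w1)"
    using eng.IH(1) 2 by blast
  show ?case
    using 1 2 rat_map_comp[OF S_elements_PGL2[OF eng.hyps(2)] S_elements_PGL2[OF eng.hyps(1)] 2(2) 1(2)]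
      rat_equiv_trans by (auto simp: PGL2_simps)
qed

lemma R_cubic_equiv_iff_S_orbit:
  fixes c c' :: "'a::alg_closed_field"
  assumes two: "(2 :: 'a) \<noteq> 0" and c: "c \<notin> {0, 1}" and c': "c' \<notin> {0, 1}"
  shows "rat_equiv (R_cubic c) (R_cubic c') \<longleftrightarrow> same_S_orbit c c'"
proof
  assume "same_S_orbit c c'"
  then obtain z s s' where z: "z \<notin> {0, 1}" "s \<in> S_elements" "s' \<in> S_elements"
    "Aff c = rat_map s (Aff z)" "Aff c' = rat_map s' (Aff z)"
    unfolding same_S_orbit_iff by blast
  then have "rat_equiv (R_cubic z) (R_cubic c)" "rat_equiv (R_cubic z) (R_cubic c')"
    using S_orbit_equiv[OF two z(2,1)] S_orbit_equiv[OF two z(3,1)] by auto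
  then show "rat_equiv (R_cubic c) (R_cubic c')"
    using rat_equiv_sym rat_equiv_trans by blast
next
  assume "rat_equiv (R_cubic c) (R_cubic c')"
  then have c'_cases: "c' \<in> {c, 1 / c, 1 - c, 1 / (1 - c), 1 - 1 / c, 1 - 1 / (1 - c)}"
    using R_cubic_equiv_imp_orbit[OF two] c c' by blast
  \<comment> \<open>The values reached from \<open>c\<close> are closed under
    \<open>w \<mapsto> 1 / w\<close> for nonzero \<open>w\<close> and
    \<open>w \<mapsto> 1 - w\<close>, hence include all six candidates for
    \<open>c'\<close>.\<close>
  define reach where "reach w \<longleftrightarrow> (\<exists>s \<in> S_elements. rat_map s (Aff c) = Aff w)" for w
  have step: "reach w'"
    if "reach w" "s \<in> {Fract 1 [:0, 1:], Fract [:1, - 1:] 1}" "rat_map s (Aff w) = Aff w'" for w w' s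
  proof -
    from that(1) obtain t where t: "t \<in> S_elements" "rat_map t (Aff c) = Aff w"
      by (auto simp: reach_def)
    have s: "s \<in> S_elements" using that(2) by (rule generate.incl)
    have "rat_comp s t \<in> S_elements" using generate.eng[OF s t(1)] by (simp add: PGL2_simps)
    moreover have "rat_map (rat_comp s t) (Aff c) = Aff w'"
      by (rule rat_map_comp[OF S_elements_PGL2[OF t(1)] S_elements_PGL2[OF s] t(2) that(3)])
    ultimately show ?thesis by (auto simp: reach_def)
  qed
  have inverse: "reach (1 / w)" if "reach w" "w \<noteq> 0" for w
    using step[OF that(1), of "Fract 1 [:0, 1:]"] that(2) by (simp add: rat_map_S_generators)
  have reflect: "reach (1 - w)" if "reach w" for w
    using step[OF that, of "Fract [:1, - 1:] 1"] by (simp add: rat_map_S_generators)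
  have one: "rat_X \<in> S_elements" "rat_map rat_X (Aff c) = Aff c"
    using generate.one[of PGL2] rat_map_moeb[of 1 1 0 0 c] by (simp_all add: PGL2_simps moeb_scalar)
  then have "reach c" by (auto simp: reach_def)
  then have "reach c'" using c'_cases c inverse reflect by auto
  then show "same_S_orbit c c'"
    unfolding same_S_orbit_iff reach_def using one c by metis
qed

theorem theorem4p1:
  assumes "CHAR('a::alg_closed_field) \<noteq> 2" and "CHAR('a) \<noteq> 3"
  shows
    "(\<forall>R :: 'a poly fract. rat_degree R = 3 \<longrightarrow>
        rat_equiv R (Fract [:0, 0, 0, 1:] 1) \<or>
        (\<exists>c. c \<notin> {0, 1} \<and> rat_equiv R (R_cubic c))) \<and>
     (\<forall>c c' :: 'a. c \<notin> {0, 1} \<longrightarrow> c' \<notin> {0, 1} \<longrightarrow>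
        (rat_equiv (R_cubic c) (R_cubic c') \<longleftrightarrow> same_S_orbit c c')) \<and>
     (\<forall>c :: 'a. c \<notin> {0, 1} \<longrightarrow>
        rat_degree (R_cubic c) = 3 \<and>
        ramification_points (R_cubic c) = {Infty, Aff 0, Aff 1, ram_lambda c} \<and>
        rat_map (R_cubic c) Infty = Infty \<and>
        rat_map (R_cubic c) (Aff 0) = Aff 0 \<and>
        rat_map (R_cubic c) (Aff 1) = Aff 1 \<and>
        rat_map (R_cubic c) (ram_lambda c) = branch_mu c \<and>
        (distinct [Infty, Aff 0, Aff 1, ram_lambda c] \<longleftrightarrow> c \<notin> {1 / 2, 2, - 1}) \<and>
        (distinct [Infty, Aff 0, Aff 1, branch_mu c] \<longleftrightarrow> c \<notin> {1 / 2, 2, - 1})) \<and>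
     (\<forall>c \<in> {1 / 2, 2, - 1 :: 'a}. rat_equiv (R_cubic c) (R_cubic (1 / 2))) \<and>
     R_cubic (1 / 2 :: 'a) = Fract [:0, 0, 3, - 2:] 1 \<and>
     ramification_points (R_cubic (1 / 2 :: 'a)) = {Infty, Aff 0, Aff 1} \<and>
     ram_index (R_cubic (1 / 2 :: 'a)) Infty = 3"
proof -
  have two: "(2 :: 'a) \<noteq> 0" using CHAR_neq_imp[OF assms(1)] by simp
  have three: "(3 :: 'a) \<noteq> 0" using CHAR_neq_imp[OF assms(2)] by simp
  have "(2 :: 'a) \<noteq> 1" by (metis add_cancel_right_right one_add_one zero_neq_one)
  then have half: "1 / 2 \<noteq> (0 :: 'a)" "1 / 2 \<noteq> (1 :: 'a)" "(2 :: 'a) \<noteq> 0" "(2 :: 'a) \<noteq> 1"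
    "(-1 :: 'a) \<noteq> 0" "(-1 :: 'a) \<noteq> 1"
    using two by (auto simp: field_simps eq_neg_iff_add_eq_0 neg_eq_iff_add_eq_0)
  show ?thesis
  proof (intro conjI allI impI ballI)
    fix R :: "'a poly fract"
    assume "rat_degree R = 3"
    then show "rat_equiv R (Fract [:0, 0, 0, 1:] 1) \<or> (\<exists>c. c \<notin> {0, 1} \<and> rat_equiv R (R_cubic c))"
      using standard_degree_3[OF two three] by (simp add: standard_def)
  next
    fix c c' :: 'a
    assume "c \<notin> {0, 1}" "c' \<notin> {0, 1}"
    then show "rat_equiv (R_cubic c) (R_cubic c') \<longleftrightarrow> same_S_orbit c c'"
      by (rule R_cubic_equiv_iff_S_orbit[OF two])
  next
    fix c :: 'a
    assume "c \<notin> {0, 1}"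
    then have c: "c \<noteq> 0" "c \<noteq> 1" by auto
    note ctxt = two c
    show "rat_degree (R_cubic c) = 3" by (rule degree_R_cubic[OF ctxt])
    show "ramification_points (R_cubic c) = {Infty, Aff 0, Aff 1, ram_lambda c}"
      by (rule ramification_points_R_cubic[OF ctxt three])
    show "rat_map (R_cubic c) Infty = Infty" by (rule R_cubic_Infty[OF ctxt])
    show "rat_map (R_cubic c) (Aff 0) = Aff 0" "rat_map (R_cubic c) (Aff 1) = Aff 1"
      using c by (auto simp: R_cubic_Aff[OF ctxt])
    show "rat_map (R_cubic c) (ram_lambda c) = branch_mu c" by (rule R_cubic_ram_lambda[OF ctxt])
    show "distinct [Infty, Aff 0, Aff 1, ram_lambda c] \<longleftrightarrow> c \<notin> {1 / 2, 2, - 1}"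
      by (rule distinct_ram_lambda[OF ctxt])
    show "distinct [Infty, Aff 0, Aff 1, branch_mu c] \<longleftrightarrow> c \<notin> {1 / 2, 2, - 1}"
      by (rule distinct_branch_mu[OF ctxt])
  next
    fix c :: 'a
    assume "c \<in> {1 / 2, 2, - 1}"
    moreover have "rat_equiv (R_cubic (1 / 2)) (R_cubic (1 / 2 :: 'a))"
      by (intro rat_equiv_refl nonconst_R_cubic two half)
    moreover have 2: "rat_equiv (R_cubic 2) (R_cubic (1 / 2 :: 'a))"
      by (intro R_cubic_equiv_inverse two half)
    \<comment> \<open>Reflection takes -1 to 2, which inversion takes to
      \<open>1 / 2\<close>.\<close>
    moreover have "rat_equiv (R_cubic (- 1)) (R_cubic (1 - (- 1) :: 'a))"
      by (intro R_cubic_equiv_reflect two half)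
    then have "rat_equiv (R_cubic (- 1)) (R_cubic (1 / 2 :: 'a))"
      using rat_equiv_trans[OF _ 2] by simp
    ultimately show "rat_equiv (R_cubic c) (R_cubic (1 / 2))" by blast
  next
    show "R_cubic (1 / 2 :: 'a) = Fract [:0, 0, 3, - 2:] 1" by (rule R_cubic_half[OF two])
    have "2 * (1 / 2 :: 'a) - 1 = 0" using two by simp
    then show "ramification_points (R_cubic (1 / 2 :: 'a)) = {Infty, Aff 0, Aff 1}"
      "ram_index (R_cubic (1 / 2 :: 'a)) Infty = 3"
      using ramification_points_R_cubic[OF two half(1,2) three] ram_index_R_cubic_Infty[OF two half(1,2)]
      by (auto simp: ram_lambda_def)
  qed
qed

end
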